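(* Let $k\ge 3$ and $n\ge 3k+1$ be integers. If $G$ is a connected graph with $n$ vertices and at most $\left(1+\frac{1}{27k^2}\right)n$ edges, then $r(G,C_k)\le 2n+k-2$.
   Context: All graphs are finite and simple. For graphs $H_1,H_2$, the Ramsey number $r(H_1,H_2)$ is the smallest positive integer $N$ such that every graph $\Gamma$ on $N$ vertices contains $H_1$ as a (not necessarily induced) subgraph or its complement $\overline{\Gamma}$ contains $H_2$ as a subgraph. $C_k$ is the cycle on $k$ vertices (here $k$ may be odd or even). *)

theory Defs
  imports Complex_Main "HOL-Library.Ramsey" "Graph_Theory.Digraph_Isomorphism"
begin

text \<open>
  Following the AFP entry Graph_Theory, a finite simple graph is a \<^locale>\<open>pair_graph\<close>: a finite,
  loop-free digraph whose arc relation is symmetric. Each undirected edge \<open>{u, v}\<close> is thus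
  represented by the two arcs \<open>(u, v)\<close> and \<open>(v, u)\<close>, so edges are not counted by
  \<open>card (parcs G)\<close> but by the cardinality of the following set of two-element sets.
\<close>

definition uedges :: "'a pair_pre_digraph \<Rightarrow> 'a set set" where
  "uedges G = {{u, v} | u v. (u, v) \<in> parcs G}"

definition complement :: "'a pair_pre_digraph \<Rightarrow> 'a pair_pre_digraph" where
  "complement G = \<lparr> pverts = pverts G,
     parcs = {(u, v). u \<in> pverts G \<and> v \<in> pverts G \<and> u \<noteq> v \<and> (u, v) \<notin> parcs G} \<rparr>"

definition contains_copy :: "'a pair_pre_digraph \<Rightarrow> 'b pair_pre_digraph \<Rightarrow> bool" where
  "contains_copy G H \<longleftrightarrow>
     (\<exists>K :: 'a pair_pre_digraph. subgraph (with_proj K) (with_proj G) \<and>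
        digraph_iso (with_proj H) (with_proj K))"

text \<open>The vertices of \<open>C\<^sub>k\<close> are the residues modulo \<open>k\<close>; this is the intended cycle for \<open>k \<ge> 3\<close>.\<close>

definition cycle_graph :: "nat \<Rightarrow> nat pair_pre_digraph" where
  "cycle_graph k = \<lparr> pverts = {..<k},
     parcs = {(i, j). i < k \<and> j < k \<and> (j = Suc i mod k \<or> i = Suc j mod k)} \<rparr>"

text \<open>
  The host graphs range over all finite simple graphs with vertices in \<^typ>\<open>nat\<close>, hence over all
  finite simple graphs up to isomorphism.
\<close>

definition ramsey_property :: "'a pair_pre_digraph \<Rightarrow> 'b pair_pre_digraph \<Rightarrow> nat \<Rightarrow> bool" where
  "ramsey_property H1 H2 N \<longleftrightarrow>
     (\<forall>\<Gamma> :: nat pair_pre_digraph. pair_graph \<Gamma> \<and> card (pverts \<Gamma>) = N \<longrightarrow>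
        contains_copy \<Gamma> H1 \<or> contains_copy (complement \<Gamma>) H2)"

definition ramsey_number :: "'a pair_pre_digraph \<Rightarrow> 'b pair_pre_digraph \<Rightarrow> nat" where
  "ramsey_number H1 H2 = (LEAST N. N \<ge> 1 \<and> ramsey_property H1 H2 N)"

lemma pair_graph_complement:
  assumes "pair_graph G"
  shows "pair_graph (complement G)"
proof -
  interpret pair_graph G by fact
  have "parcs (complement G) \<subseteq> pverts G \<times> pverts G"
    by (auto simp: complement_def)
  then have "finite (parcs (complement G))"
    by (rule finite_subset) simp
  then show ?thesis
    by unfold_locales
      (auto simp: complement_def symmetric_def intro!: symI dest: arcs_symmetric)
qed

lemma pair_graph_cycle_graph:
  assumes "k \<ge> 3"
  shows "pair_graph (cycle_graph k)"
proof -
  have "parcs (cycle_graph k) \<subseteq> {..<k} \<times> {..<k}"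
    by (auto simp: cycle_graph_def)
  then have fin: "finite (parcs (cycle_graph k))"
    by (rule finite_subset) simp
  have ne: "Suc i mod k \<noteq> i" if "i < k" for i
    using that assms by (cases "Suc i = k") auto
  show ?thesis
    using fin by unfold_locales (auto simp: cycle_graph_def symmetric_def ne intro!: symI dest: ne)
qed

lemma contains_copy_iff:
  fixes G :: "'a pair_pre_digraph" and H :: "'b pair_pre_digraph"
  assumes "pair_graph G" "pair_graph H"
  shows "contains_copy G H \<longleftrightarrow>
    (\<exists>f. inj_on f (pverts H) \<and> f ` pverts H \<subseteq> pverts G \<and>
         (\<forall>(u, v) \<in> parcs H. (f u, f v) \<in> parcs G))"
proof
  assume "contains_copy G H"
  then obtain K :: "'a pair_pre_digraph" and h where
    sub: "subgraph (with_proj K) (with_proj G)" and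
    h: "pre_digraph.digraph_isomorphism (with_proj H) h" and
    K: "with_proj K = app_iso h (with_proj H)"
    unfolding contains_copy_def digraph_iso_def by blast
  have V: "pverts K = iso_verts h ` pverts H" and A: "parcs K = iso_arcs h ` parcs H"
    and T: "iso_tail h = fst" and D: "iso_head h = snd"
    using arg_cong[OF K, of verts] arg_cong[OF K, of arcs]
      arg_cong[OF K, of tail] arg_cong[OF K, of head] by auto
  have "(iso_verts h u, iso_verts h v) \<in> parcs G" if "(u, v) \<in> parcs H" for u v
  proof -
    have "iso_arcs h (u, v) = (iso_verts h u, iso_verts h v)"
      using h that T D by (auto simp: pre_digraph.digraph_isomorphism_def prod_eq_iff)
    moreover have "iso_arcs h (u, v) \<in> parcs G"
      using sub A that by (auto simp: subgraph_def)
    ultimately show ?thesis by simp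
  qed
  moreover have "inj_on (iso_verts h) (pverts H)"
    using h by (auto simp: pre_digraph.digraph_isomorphism_def)
  moreover have "iso_verts h ` pverts H \<subseteq> pverts G"
    using sub V by (auto simp: subgraph_def)
  ultimately show "\<exists>f. inj_on f (pverts H) \<and> f ` pverts H \<subseteq> pverts G \<and>
         (\<forall>(u, v) \<in> parcs H. (f u, f v) \<in> parcs G)"
    by (intro exI[of _ "iso_verts h"]) auto
next
  assume "\<exists>f. inj_on f (pverts H) \<and> f ` pverts H \<subseteq> pverts G \<and>
         (\<forall>(u, v) \<in> parcs H. (f u, f v) \<in> parcs G)"
  then obtain f where f: "inj_on f (pverts H)" "f ` pverts H \<subseteq> pverts G"
    "\<forall>(u, v) \<in> parcs H. (f u, f v) \<in> parcs G"
    by (elim exE conjE)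
  interpret G: pair_graph G by fact
  interpret H: pair_graph H by fact
  define h where "h = \<lparr> iso_verts = f, iso_arcs = map_prod f f,
    iso_head = snd :: 'a \<times> 'a \<Rightarrow> 'a, iso_tail = fst :: 'a \<times> 'a \<Rightarrow> 'a \<rparr>"
  define K where "K = \<lparr> pverts = f ` pverts H, parcs = map_prod f f ` parcs H \<rparr>"
  have arcs_sub: "parcs H \<subseteq> pverts H \<times> pverts H"
    using H.in_arcsD1 H.in_arcsD2 by auto
  have "inj_on (map_prod f f) (parcs H)"
    using map_prod_inj_on[OF f(1) f(1)] arcs_sub by (rule inj_on_subset)
  then have "pre_digraph.digraph_isomorphism (with_proj H) h"
    unfolding pre_digraph.digraph_isomorphism_def using f(1) H.wf_digraph by (auto simp: h_def)
  moreover have "with_proj K = app_iso h (with_proj H)"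
    by (simp add: with_proj_def app_iso_def K_def h_def)
  moreover have "wf_digraph (with_proj K)"
    using arcs_sub by unfold_locales (auto simp: K_def)
  then have "subgraph (with_proj K) (with_proj G)"
    unfolding subgraph_def using f(2,3) G.wf_digraph by (auto simp: K_def)
  ultimately show "contains_copy G H"
    unfolding contains_copy_def digraph_iso_def by blast
qed

lemma contains_copyI:
  assumes "pair_graph G" "pair_graph H" "inj_on f (pverts H)" "f ` pverts H \<subseteq> pverts G"
    and "\<And>u v. (u, v) \<in> parcs H \<Longrightarrow> (f u, f v) \<in> parcs G"
  shows "contains_copy G H"
  unfolding contains_copy_iff[OF assms(1,2)] using assms(3-5)
  by (intro exI[of _ f] conjI ballI) (simp_all add: case_prod_beta)

text \<open>By Ramsey's theorem the minimum in \<^const>\<open>ramsey_number\<close> is attained.\<close>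

lemma ramsey_number_attained:
  fixes H1 :: "'a pair_pre_digraph" and H2 :: "'b pair_pre_digraph"
  assumes "pair_graph H1" "pair_graph H2"
  shows "ramsey_number H1 H2 \<ge> 1 \<and> ramsey_property H1 H2 (ramsey_number H1 H2)"
proof -
  interpret H1: pair_graph H1 by fact
  interpret H2: pair_graph H2 by fact
  have emb: "\<exists>f. inj_on f (pverts H) \<and> f ` pverts H \<subseteq> R"
    if "finite (pverts H)" "finite R" "card R = card (pverts H)"
    for H :: "'c pair_pre_digraph" and R :: "nat set"
    using that finite_same_card_bij[of "pverts H" R] by (auto simp: bij_betw_def)
  obtain r :: nat where r: "r \<ge> 1"
    "\<And>(V :: nat set) E. finite V \<Longrightarrow> card V \<ge> r \<Longrightarrow>
      \<exists>R \<subseteq> V. card R = card (pverts H1) \<and> clique R E \<or> card R = card (pverts H2) \<and> indep R E"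
    using ramsey2[of "card (pverts H1)" "card (pverts H2)"] by blast
  have "ramsey_property H1 H2 r"
    unfolding ramsey_property_def
  proof (intro allI impI)
    fix \<Gamma> :: "nat pair_pre_digraph"
    assume *: "pair_graph \<Gamma> \<and> card (pverts \<Gamma>) = r"
    interpret pair_graph \<Gamma> using * by blast
    have E: "{u, v} \<in> uedges \<Gamma> \<longleftrightarrow> (u, v) \<in> parcs \<Gamma>" for u v
      by (auto simp: uedges_def doubleton_eq_iff dest: arcs_symmetric)
    obtain R where R: "R \<subseteq> pverts \<Gamma>"
      "card R = card (pverts H1) \<and> clique R (uedges \<Gamma>) \<or>
       card R = card (pverts H2) \<and> indep R (uedges \<Gamma>)"
      using r(2)[of "pverts \<Gamma>" "uedges \<Gamma>"] * by auto
    have finR: "finite R" using R(1) by (rule finite_subset) simp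
    from R(2) show "contains_copy \<Gamma> H1 \<or> contains_copy (complement \<Gamma>) H2"
    proof
      assume c: "card R = card (pverts H1) \<and> clique R (uedges \<Gamma>)"
      then obtain f where f: "inj_on f (pverts H1)" "f ` pverts H1 \<subseteq> R"
        using emb[of H1 R] finR by auto
      have "(f u, f v) \<in> parcs \<Gamma>" if "(u, v) \<in> parcs H1" for u v
      proof -
        have "u \<in> pverts H1" "v \<in> pverts H1" "u \<noteq> v"
          using H1.in_arcsD1[OF that] H1.in_arcsD2[OF that] H1.no_loops[OF that] by auto
        then have "f u \<in> R" "f v \<in> R" "f u \<noteq> f v"
          using f by (auto simp: inj_on_eq_iff)
        then show ?thesis using c E by (auto simp: clique_def)
      qed
      moreover have "f ` pverts H1 \<subseteq> pverts \<Gamma>" using f(2) R(1) by (rule subset_trans)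
      ultimately have "contains_copy \<Gamma> H1"
        using conjunct1[OF *] assms(1) f(1) by (intro contains_copyI[of _ _ f]) simp_all
      then show ?thesis ..
    next
      assume c: "card R = card (pverts H2) \<and> indep R (uedges \<Gamma>)"
      then obtain f where f: "inj_on f (pverts H2)" "f ` pverts H2 \<subseteq> R"
        using emb[of H2 R] finR by auto
      have "(f u, f v) \<in> parcs (complement \<Gamma>)" if "(u, v) \<in> parcs H2" for u v
      proof -
        have "u \<in> pverts H2" "v \<in> pverts H2" "u \<noteq> v"
          using H2.in_arcsD1[OF that] H2.in_arcsD2[OF that] H2.no_loops[OF that] by auto
        then have "f u \<in> R" "f v \<in> R" "f u \<noteq> f v"
          using f by (auto simp: inj_on_eq_iff)
        then show ?thesis
          using c E R(1) by (auto simp: indep_def complement_def)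
      qed
      moreover have "f ` pverts H2 \<subseteq> pverts (complement \<Gamma>)"
        using subset_trans[OF f(2) R(1)] by (simp add: complement_def)
      ultimately have "contains_copy (complement \<Gamma>) H2"
        using pair_graph_complement[OF conjunct1[OF *]] assms(2) f(1)
        by (intro contains_copyI[of _ _ f]) simp_all
      then show ?thesis ..
    qed
  qed
  then have "\<exists>N. N \<ge> 1 \<and> ramsey_property H1 H2 N"
    using r(1) by blast
  then show ?thesis
    unfolding ramsey_number_def by (rule LeastI_ex)
qed

end

theory Submission
  imports Defs
begin

text \<open>
  Colour the edges of \<open>\<Gamma>\<close> blue and those of its complement red, and suppose that there is no red
  \<open>C\<^sub>k\<close>. Then red neighbourhoods contain no red path on \<open>k - 1\<close> vertices, and depth-first search
  turns such a set into an almost spanning complete bipartite blue graph with large blue cliques on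
  both sides. As \<open>G\<close> is bipartite up to few edges, it embeds into any red neighbourhood of
  size \<open>n + k - 1\<close>. So we may assume that all blue degrees are at least \<open>n - 1\<close>, and leaves of \<open>G\<close> can
  be attached greedily. A graph without leaves and small excess either is a cycle, or is so small
  that a greedy embedding works, or has a long suspended path. In the last case shorten the path,
  embed by induction, and insert an outside vertex into the blue path: if no vertex can be inserted,
  all outside vertices are red to almost the entire path, which gives a red \<open>C\<^sub>k\<close>.
\<close>

section \<open>Path-free sets\<close>

text \<open>Let \<open>G\<close> have \<open>n - 1 + t\<close> edges. The density hypothesis then
  reads \<open>27 * k^2 * (t - 1) <= n\<close>: it is empty for \<open>t <= 1\<close>, so trees and
  unicyclic graphs must be handled from \<open>n >= 3 * k + 1\<close> alone. The obstacle inside a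
  red neighbourhood is that the parity classes of a breadth-first tree can be very unequal, and the
  smaller one may have no room for the edges that stay inside it. For \<open>t = 1\<close> the
  colours are then swapped on a subtree; for \<open>t >= 2\<close> a tiny class forces most vertices
  to be leaves, and the classes are chosen afresh. Outside that case the induction loses one vertex
  and one edge at a time, so \<open>t\<close> is invariant while \<open>n\<close> stays fixed. The
  constant 27 covers two estimates: at most \<open>8 * k * (t - 1)\<close> hubs, each demanding
  \<open>3 * k - 5\<close> vertices, and, if there is no path with \<open>3 * k\<close> inner
  vertices of degree 2, at most \<open>6 * (t - 1) * (3 * k + 1)\<close> arcs in a leafless graph,
  each costing \<open>k - 2\<close> host vertices.\<close>

definition path_free :: "('b \<Rightarrow> 'b \<Rightarrow> bool) \<Rightarrow> 'b set \<Rightarrow> nat \<Rightarrow> bool" where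
  "path_free R W m \<longleftrightarrow>
     (\<forall>xs. distinct xs \<and> set xs \<subseteq> W \<and> successively R xs \<longrightarrow> length xs < m)"

definition cycle_free :: "('b \<Rightarrow> 'b \<Rightarrow> bool) \<Rightarrow> 'b set \<Rightarrow> nat \<Rightarrow> bool" where
  "cycle_free R X k \<longleftrightarrow>
     (\<forall>xs. distinct xs \<and> set xs \<subseteq> X \<and> successively R xs \<and> length xs = k \<longrightarrow> \<not> R (last xs) (hd xs))"

text \<open>\<open>R\<close> is the red relation and blue is its absence. A vertex thus counts as
  blue to itself; injectivity of \<open>f\<close> and loop-freeness of the pattern turn this into
  genuine blue edges when the result is read off.\<close>

definition embeds :: "'a set \<Rightarrow> 'a rel \<Rightarrow> ('b \<Rightarrow> 'b \<Rightarrow> bool) \<Rightarrow> 'b set \<Rightarrow> bool" where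
  "embeds V E R W \<longleftrightarrow>
     (\<exists>f. inj_on f V \<and> f ` V \<subseteq> W \<and> (\<forall>(u, v) \<in> E. \<not> R (f u) (f v)))"

lemma embedsI:
  assumes "inj_on f V" "f ` V \<subseteq> W" "\<And>u v. (u, v) \<in> E \<Longrightarrow> \<not> R (f u) (f v)"
  shows "embeds V E R W"
proof -
  have "\<forall>(u, v) \<in> E. \<not> R (f u) (f v)" using assms(3) by fast
  then show ?thesis unfolding embeds_def using assms(1,2) by iprover
qed

lemma embedsE:
  assumes "embeds V E R W"
  obtains f where "inj_on f V" "f ` V \<subseteq> W" "\<And>u v. (u, v) \<in> E \<Longrightarrow> \<not> R (f u) (f v)"
proof -
  obtain f where "inj_on f V" "f ` V \<subseteq> W" "\<forall>(u, v) \<in> E. \<not> R (f u) (f v)"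
    using assms unfolding embeds_def by iprover
  then show thesis by (intro that[of f]) auto
qed

lemma embeds_mono:
  assumes "embeds V E R W" "W \<subseteq> W'"
  shows "embeds V E R W'"
  using assms(1)
proof (rule embedsE)
  fix f assume "inj_on f V" "f ` V \<subseteq> W" "\<And>u v. (u, v) \<in> E \<Longrightarrow> \<not> R (f u) (f v)"
  then show ?thesis using assms(2) by (intro embedsI[of f]) auto
qed

lemma path_freeD: "path_free R W m \<Longrightarrow> distinct xs \<Longrightarrow> set xs \<subseteq> W \<Longrightarrow> successively R xs \<Longrightarrow> length xs < m"
  by (auto simp: path_free_def)

lemma path_free_mono: "path_free R W m \<Longrightarrow> W' \<subseteq> W \<Longrightarrow> path_free R W' m"
  by (auto simp: path_free_def)

text \<open>A red path on \<open>k - 1\<close> vertices in the red neighbourhood of \<open>v\<close>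
  closes through \<open>v\<close> to a red cycle on \<open>k\<close> vertices; a longer path is
  first cut to this length.\<close>

lemma path_free_nbhd:
  assumes "cycle_free R X k" "symp R" "v \<in> X" "W \<subseteq> X" "v \<notin> W" "\<And>w. w \<in> W \<Longrightarrow> R v w" "k \<ge> 2"
  shows "path_free R W (k - 1)"
  unfolding path_free_def
proof (intro allI impI)
  fix xs assume xs: "distinct xs \<and> set xs \<subseteq> W \<and> successively R xs"
  show "length xs < k - 1"
  proof (rule ccontr)
    assume "\<not> length xs < k - 1"
    define ys where "ys = v # take (k - 1) xs"
    have ne: "take (k - 1) xs \<noteq> []" and len: "length (take (k - 1) xs) = k - 1"
      using \<open>\<not> length xs < k - 1\<close> assms(7) by auto
    have sub: "set (take (k - 1) xs) \<subseteq> W" using xs set_take_subset[of "k - 1" xs] by auto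
    have "successively R (take (k - 1) xs @ drop (k - 1) xs)" using xs by simp
    then have "successively R (take (k - 1) xs)" by (simp only: successively_append_iff)
    then have "successively R ys"
      using ne sub assms(6) hd_in_set[OF ne] by (auto simp: ys_def successively_Cons)
    moreover have "distinct ys" using xs sub assms(5) by (auto simp: ys_def)
    moreover have "set ys \<subseteq> X" using sub assms(3,4) by (auto simp: ys_def)
    moreover have "length ys = k" using len assms(7) by (simp add: ys_def)
    ultimately have "\<not> R (last ys) (hd ys)" using assms(1) by (auto simp: cycle_free_def)
    moreover have "R v (last (take (k - 1) xs))" using last_in_set[OF ne] sub assms(6) by auto
    moreover have "last ys = last (take (k - 1) xs)" "hd ys = v"
      using ne by (simp_all add: ys_def)
    ultimately show False using sympD[OF assms(2)] by metis
  qed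
qed

text \<open>The stack \<open>P\<close> of a depth-first search is a path, and no edge joins the finished vertices
  \<open>F\<close> to the unvisited vertices \<open>U\<close>; just after a vertex is finished the stack is one vertex shorter
  than a path.\<close>

lemma dfs_state:
  assumes "finite W" "path_free R W m" "m \<ge> 2" "symp R" "a \<le> card W"
  shows "\<exists>F P U. W = F \<union> set P \<union> U \<and> F \<inter> set P = {} \<and> F \<inter> U = {} \<and> set P \<inter> U = {} \<and>
    distinct P \<and> successively R P \<and> length P \<le> m - 2 \<and> card F = a \<and>
    (\<forall>x\<in>F. \<forall>y\<in>U. \<not> R x y)"
  using assms(5)
proof (induction a)
  case 0
  show ?case by (rule exI[of _ "{}"], rule exI[of _ "[]"], rule exI[of _ W]) auto
next
  case (Suc a)
  then obtain F P0 U0 where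
    *: "W = F \<union> set P0 \<union> U0" "F \<inter> set P0 = {}" "F \<inter> U0 = {}" "set P0 \<inter> U0 = {}"
    "distinct P0" "successively R P0" "card F = a" "\<forall>x\<in>F. \<forall>y\<in>U0. \<not> R x y"
    by auto
  \<comment> \<open>Instead of pushing vertices one at a time, take a longest red path outside
    \<open>F\<close> that still covers the old stack. Covering it keeps the new \<open>U\<close>
    inside \<open>U0\<close>, and by maximality the head of the path has no red neighbour in
    \<open>U\<close>, so it can be finished.\<close>
  define Q where "Q P \<longleftrightarrow> distinct P \<and> successively R P \<and> set P0 \<subseteq> set P \<and> set P \<subseteq> W - F" for P
  have Q0: "Q P0" using * by (auto simp: Q_def)
  have bd: "length P < m" if "Q P" for P
    using that path_freeD[OF assms(2)] by (auto simp: Q_def)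
  define P where "P = (ARG_MAX length P. Q P)"
  have QP: "Q P" and max: "\<And>P'. Q P' \<Longrightarrow> length P' \<le> length P"
    unfolding P_def using arg_max_nat_lemma[of Q P0 length m] Q0 bd by (auto intro: less_imp_le)
  have "P \<noteq> []"
  proof
    assume "P = []"
    then have "P0 = []" using QP by (auto simp: Q_def)
    have "card F < card W" using Suc.prems * by simp
    then obtain x where "x \<in> W - F" using *(1) by (metis Diff_eq_empty_iff card_mono
          equals0I finite_Un finite_subset assms(1) leD subset_refl Un_upper1)
    then have "Q [x]" using \<open>P0 = []\<close> by (auto simp: Q_def)
    from max[OF this] \<open>P = []\<close> show False by simp
  qed
  then obtain p P' where P: "P = p # P'" by (cases P) auto
  define U where "U = W - F - set P"
  have noU: "\<not> R p y" if "y \<in> U" for y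
  proof
    assume "R p y"
    then have "Q (y # P)"
      using QP that sympD[OF assms(4)] by (auto simp: Q_def U_def P)
    from max[OF this] show False by simp
  qed
  have finF: "finite F" using *(1) assms(1) by simp
  have 1: "W = insert p F \<union> set P' \<union> U" using QP *(1) by (auto simp: U_def P Q_def)
  have 2: "insert p F \<inter> set P' = {}" using QP by (auto simp: P Q_def)
  have 3: "insert p F \<inter> U = {}" "set P' \<inter> U = {}" by (auto simp: U_def P)
  have 4: "distinct P'" "successively R P'" "length P' \<le> m - 2"
    using QP bd[OF QP] by (auto simp: P Q_def successively_Cons)
  have 5: "card (insert p F) = Suc a"
    using QP finF *(7) by (subst card_insert_disjoint) (auto simp: P Q_def)
  have 6: "\<forall>x\<in>insert p F. \<forall>y\<in>U. \<not> R x y"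
    using noU *(1,8) QP by (auto simp: U_def Q_def)
  show ?case
    using 1 2 3 4 5 6 by (intro exI[of _ "insert p F"] exI[of _ P'] exI[of _ U]) auto
qed

text \<open>The search is stopped when exactly \<open>a\<close> vertices are finished. Discarding
  the stack is the only loss, which is the summand \<open>m - 2\<close>.\<close>

lemma dfs_split:
  assumes "finite W" "path_free R W m" "m \<ge> 2" "symp R" "a + b + (m - 2) \<le> card W"
  obtains F U where "F \<subseteq> W" "U \<subseteq> W" "F \<inter> U = {}" "card F = a" "card U = b"
    "\<And>x y. x \<in> F \<Longrightarrow> y \<in> U \<Longrightarrow> \<not> R x y"
proof -
  obtain F P U where *: "W = F \<union> set P \<union> U" "F \<inter> U = {}" "F \<inter> set P = {}" "set P \<inter> U = {}"
    "length P \<le> m - 2" "card F = a" "\<forall>x\<in>F. \<forall>y\<in>U. \<not> R x y"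
    using dfs_state[OF assms(1-4), of a] assms(5) by auto
  have fin: "finite F" "finite U" using *(1) assms(1) by auto
  have "card W = card F + card (set P) + card U"
    using *(1-4) fin by (simp add: card_Un_disjoint Int_Un_distrib2)
  then have "b \<le> card U" using * assms(5) card_length[of P] by linarith
  then obtain U' where U': "U' \<subseteq> U" "card U' = b" using obtain_subset_with_card_n by metis
  show thesis
  proof (rule that[of F U'])
    show "F \<subseteq> W" "U' \<subseteq> W" "F \<inter> U' = {}" using *(1,2) U'(1) by blast+
    show "\<not> R x y" if "x \<in> F" "y \<in> U'" for x y using *(7) U'(1) that by blast
  qed (fact *(6) U'(2))+
qed

text \<open>A split with a single finished vertex \<open>x\<close> loses at most
  \<open>m - 2\<close> further vertices, and the rest is blue to \<open>x\<close>. So each further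
  element costs \<open>m - 1\<close> vertices, as if \<open>W\<close> were coloured with
  \<open>m - 1\<close> colours.\<close>

lemma independent_set_exists:
  assumes "finite W" "path_free R W m" "m \<ge> 2" "symp R" "irreflp R"
    and "h = 0 \<or> (h - 1) * (m - 1) < card W"
  shows "\<exists>I \<subseteq> W. card I = h \<and> (\<forall>x\<in>I. \<forall>y\<in>I. \<not> R x y)"
  using assms(1,2,6)
proof (induction h arbitrary: W)
  case 0
  then show ?case by (intro exI[of _ "{}"]) auto
next
  case (Suc h)
  show ?case
  proof (cases "h = 0")
    case True
    then obtain x where "x \<in> W" using Suc.prems by fastforce
    then show ?thesis using True irreflpD[OF assms(5)] by (intro exI[of _ "{x}"]) auto
  next
    case False
    then obtain g where g: "h = Suc g" by (cases h) auto
    have sz: "1 + (g * (m - 1) + 1) + (m - 2) \<le> card W"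
    proof -
      obtain j where "m = j + 2" using assms(3) by (metis le_add_diff_inverse2)
      then show ?thesis using Suc.prems by (simp add: g)
    qed
    obtain F U where FU: "F \<subseteq> W" "U \<subseteq> W" "F \<inter> U = {}" "card F = 1"
      "card U = g * (m - 1) + 1" "\<And>x y. x \<in> F \<Longrightarrow> y \<in> U \<Longrightarrow> \<not> R x y"
      using dfs_split[OF Suc.prems(1,2) assms(3,4) sz] by metis
    have "finite U" "path_free R U m"
      using FU(2) Suc.prems finite_subset path_free_mono by metis+
    then obtain I where I: "I \<subseteq> U" "card I = h" "\<forall>x\<in>I. \<forall>y\<in>I. \<not> R x y"
      using Suc.IH[of U] FU(5) by (auto simp: g)
    obtain x where x: "F = {x}" using FU(4) by (auto simp: card_1_singleton_iff)
    have "finite I" using I(1) \<open>finite U\<close> by (rule finite_subset)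
    have "x \<notin> I" using I(1) FU(3) x by auto
    then have "card (insert x I) = Suc h" using I \<open>finite I\<close> by simp
    moreover have xI: "\<not> R x y" if "y \<in> I" for y using FU(6) x I(1) that by auto
    then have "\<not> R y x" if "y \<in> I" for y using sympD[OF assms(4)] that by metis
    then have "\<forall>y\<in>insert x I. \<forall>z\<in>insert x I. \<not> R y z"
      using I(3) xI irreflpD[OF assms(5), of x] by simp
    ultimately show ?thesis using I(1) FU(1,2) x by (intro exI[of _ "insert x I"]) auto
  qed
qed

lemma extend_injection:
  assumes "finite A" "A0 \<subseteq> A" "finite F" "I \<subseteq> F" "card I = card A0" "card A \<le> card F"
  obtains g where "inj_on g A" "g ` A \<subseteq> F" "g ` A0 \<subseteq> I"
proof -
  have fin: "finite A0" "finite I" using assms finite_subset by auto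
  obtain g0 where g0: "bij_betw g0 A0 I"
    using finite_same_card_bij[OF fin] assms(5) by metis
  have "card (A - A0) \<le> card (F - I)"
    using assms fin by (simp add: card_Diff_subset)
  then obtain g1 where g1: "inj_on g1 (A - A0)" "g1 ` (A - A0) \<subseteq> F - I"
    using card_le_inj[of "A - A0" "F - I"] assms by auto
  define g where "g x = (if x \<in> A0 then g0 x else g1 x)" for x
  have 0: "g x \<in> I" if "x \<in> A0" for x using g0 that by (auto simp: bij_betw_def g_def)
  have 1: "g x \<in> F - I" if "x \<in> A - A0" for x using g1 that by (auto simp: g_def)
  have "inj_on g A0" using bij_betw_imp_inj_on[OF g0] by (auto simp: g_def inj_on_def)
  moreover have "inj_on g (A - A0)" using g1(1) by (auto simp: g_def inj_on_def)
  moreover have "g x \<noteq> g y" if "x \<in> A0" "y \<in> A - A0" for x y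
    using 0[OF that(1)] 1[OF that(2)] by auto
  then have "g ` (A0 - (A - A0)) \<inter> g ` (A - A0 - A0) = {}" by auto
  ultimately have "inj_on g (A0 \<union> (A - A0))" unfolding inj_on_Un by simp
  moreover have "A0 \<union> (A - A0) = A" using assms(2) by auto
  moreover have "g ` A \<subseteq> F" using 0 1 assms(4) by blast
  moreover have "g ` A0 \<subseteq> I" using 0 by blast
  ultimately show thesis using that[of g] by simp
qed

text \<open>A graph that is bipartite up to edges inside \<open>A0\<close> and \<open>B0\<close>: those two sets go to independent
  sets inside the two sides of a depth-first split.\<close>

lemma embeds_almost_bipartite:
  assumes "finite W" "path_free R W m" "m \<ge> 2" "symp R" "irreflp R"
    and "finite V" "E \<subseteq> V \<times> V" "V = A \<union> B" "A \<inter> B = {}" "A0 \<subseteq> A" "B0 \<subseteq> B"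
    and "\<And>u v. (u, v) \<in> E \<Longrightarrow> u \<in> A \<Longrightarrow> v \<in> A \<Longrightarrow> u \<in> A0 \<and> v \<in> A0"
    and "\<And>u v. (u, v) \<in> E \<Longrightarrow> u \<in> B \<Longrightarrow> v \<in> B \<Longrightarrow> u \<in> B0 \<and> v \<in> B0"
    and "card A \<le> a" "card B \<le> b" "a + b + (m - 2) \<le> card W"
    and "A0 = {} \<or> (card A0 - 1) * (m - 1) < a" "B0 = {} \<or> (card B0 - 1) * (m - 1) < b"
  shows "embeds V E R W"
proof -
  obtain F U where FU: "F \<subseteq> W" "U \<subseteq> W" "F \<inter> U = {}" "card F = a" "card U = b"
      "\<And>x y. x \<in> F \<Longrightarrow> y \<in> U \<Longrightarrow> \<not> R x y"
    using dfs_split[OF assms(1-4,16)] by metis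
  have fin: "finite F" "finite U" "finite A" "finite B"
    using finite_subset[OF FU(1) assms(1)] finite_subset[OF FU(2) assms(1)] assms(6,8) by simp_all
  have pf: "path_free R F m" "path_free R U m" using path_free_mono[OF assms(2)] FU by auto
  have sz: "card A0 = 0 \<or> (card A0 - 1) * (m - 1) < card F"
    "card B0 = 0 \<or> (card B0 - 1) * (m - 1) < card U"
    using assms(17,18) FU(4,5) by auto
  obtain I where I: "I \<subseteq> F" "card I = card A0" "\<forall>x\<in>I. \<forall>y\<in>I. \<not> R x y"
    using independent_set_exists[OF fin(1) pf(1) assms(3-5) sz(1)] by auto
  obtain J where J: "J \<subseteq> U" "card J = card B0" "\<forall>x\<in>J. \<forall>y\<in>J. \<not> R x y"
    using independent_set_exists[OF fin(2) pf(2) assms(3-5) sz(2)] by auto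
  have "card A \<le> card F" "card B \<le> card U" using assms(14,15) FU(4,5) by simp_all
  then obtain g h where g: "inj_on g A" "g ` A \<subseteq> F" "g ` A0 \<subseteq> I"
    and h: "inj_on h B" "h ` B \<subseteq> U" "h ` B0 \<subseteq> J"
    using extend_injection[OF fin(3) assms(10) fin(1) I(1,2)]
      extend_injection[OF fin(4) assms(11) fin(2) J(1,2)] by metis
  define f where "f x = (if x \<in> A then g x else h x)" for x
  have fA: "f x \<in> F" if "x \<in> A" for x using g that by (auto simp: f_def)
  have fB: "f x \<in> U" if "x \<in> B" for x using h that assms(9) by (auto simp: f_def)
  have "inj_on f V"
  proof (rule inj_onI)
    fix x y assume "x \<in> V" "y \<in> V" "f x = f y"
    then consider "x \<in> A" "y \<in> A" | "x \<in> B" "y \<in> B"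
      using fA fB FU(3) assms(8) by (metis IntI UnE empty_iff)
    then show "x = y"
    proof cases
      case 1
      then show ?thesis using \<open>f x = f y\<close> inj_onD[OF g(1)] by (simp add: f_def)
    next
      case 2
      then have "x \<notin> A" "y \<notin> A" using assms(9) by auto
      then show ?thesis using 2 \<open>f x = f y\<close> inj_onD[OF h(1)] by (simp add: f_def)
    qed
  qed
  moreover have "f ` V \<subseteq> W" using fA fB FU assms(8) by auto
  moreover have "\<not> R (f u) (f v)" if "(u, v) \<in> E" for u v
  proof -
    have "u \<in> V" "v \<in> V" using that assms(7) by auto
    then consider "u \<in> A" "v \<in> A" | "u \<in> A" "v \<in> B" | "u \<in> B" "v \<in> A" | "u \<in> B" "v \<in> B"
      using assms(8) by blast
    then show ?thesis
    proof cases
      case 1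
      then have "f u \<in> I" "f v \<in> I" using assms(12)[OF that] g by (auto simp: f_def)
      then show ?thesis using I by blast
    next
      case 4
      then have "f u \<in> J" "f v \<in> J" using assms(9,11) assms(13)[OF that] h by (auto simp: f_def)
      then show ?thesis using J by blast
    next
      case 2
      then show ?thesis using FU(6)[OF fA fB] by simp
    next
      case 3
      then show ?thesis using FU(6)[OF fA fB] sympD[OF assms(4)] by metis
    qed
  qed
  ultimately show ?thesis by (rule embedsI)
qed

section \<open>Graphs without a red cycle\<close>

lemma embeds_independent:
  assumes "finite V" "finite I" "E \<subseteq> V \<times> V" "card V \<le> card I" "I \<subseteq> W" "\<And>x y. x \<in> I \<Longrightarrow> y \<in> I \<Longrightarrow> \<not> R x y"
  shows "embeds V E R W"
proof -
  obtain f where f: "inj_on f V" "f ` V \<subseteq> I"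
    using card_le_inj[OF assms(1,2,4)] by auto
  have "\<not> R (f u) (f v)" if "(u, v) \<in> E" for u v
  proof -
    have "u \<in> V" "v \<in> V" using that assms(3) by auto
    then have "f u \<in> I" "f v \<in> I" using f(2) by auto
    then show ?thesis by (rule assms(6))
  qed
  moreover have "f ` V \<subseteq> W" using f(2) assms(5) by auto
  ultimately show ?thesis using f(1) by (intro embedsI[of f])
qed

lemma card_rel_eq_sum_degree:
  assumes "finite V" "E \<subseteq> V \<times> V"
  shows "card E = (\<Sum>v\<in>V. card (E `` {v}))"
proof -
  have "E = Sigma V (\<lambda>v. E `` {v})" using assms(2) by auto
  moreover have "finite (E `` {v})" for v
    by (rule finite_subset[OF _ assms(1)]) (use assms(2) in auto)
  ultimately show ?thesis using card_SigmaI[OF assms(1), of "\<lambda>v. E `` {v}"] by simp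
qed

locale cycle_free_host =
  fixes X :: "'b set" and R :: "'b \<Rightarrow> 'b \<Rightarrow> bool" and k :: nat
  assumes finite_X: "finite X" and symp_R: "symp R" and irreflp_R: "irreflp R"
    and k_ge: "k \<ge> 3" and cycle_free: "cycle_free R X k"
begin

abbreviation B :: "'b \<Rightarrow> 'b \<Rightarrow> bool" where "B x y \<equiv> \<not> R x y"

lemma R_sym: "R x y \<longleftrightarrow> R y x"
  using symp_R by (auto dest: sympD)

lemma R_irrefl: "\<not> R x x"
  using irreflp_R by (auto dest: irreflpD)

lemma path_free_red_nbhd: "v \<in> X \<Longrightarrow> W \<subseteq> {x \<in> X. R v x} \<Longrightarrow> path_free R W (k - 1)"
  using path_free_nbhd[OF cycle_free symp_R, of v W] k_ge R_irrefl by auto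

text \<open>A vertex \<open>v\<close> of minimum degree \<open>d\<close> is embedded last. Either
  the image of some neighbour has so many red neighbours that they contain an independent set
  hosting all of \<open>V\<close>, or at most \<open>h + d * h * (k - 2)\<close> vertices are
  forbidden for \<open>v\<close>; averaging, \<open>d * Suc h <= card E\<close>, keeps this below
  \<open>card X\<close>.\<close>

lemma embeds_if_few_arcs:
  assumes "finite V" "E \<subseteq> V \<times> V" "sym E" "card E * (k - 2) + card V \<le> card X"
  shows "embeds V E R X"
  using assms
proof (induction "card V" arbitrary: V E)
  case 0
  then show ?case by (intro embedsI[of "\<lambda>_. undefined"]) auto
next
  case (Suc h)
  have ne: "V \<noteq> {}" using Suc.hyps by auto
  define d where "d = Min ((\<lambda>v. card (E `` {v})) ` V)"
  have "d \<in> (\<lambda>v. card (E `` {v})) ` V"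
    unfolding d_def using Suc.prems(1) ne by (intro Min_in) auto
  then obtain v where v: "v \<in> V" "card (E `` {v}) = d" by auto
  have "(\<Sum>v\<in>V. d) \<le> (\<Sum>v\<in>V. card (E `` {v}))"
    unfolding d_def using Suc.prems(1) by (intro sum_mono) simp
  then have dE: "d * Suc h \<le> card E"
    using card_rel_eq_sum_degree[OF Suc.prems(1,2)] Suc.hyps by (simp add: mult.commute)
  define V' where "V' = V - {v}"
  define E' where "E' = E \<inter> V' \<times> V'"
  have finE: "finite E" using Suc.prems(1,2) finite_subset by blast
  have V': "h = card V'" "finite V'" using Suc.hyps(2) Suc.prems(1) v by (auto simp: V'_def)
  have "card E' \<le> card E" unfolding E'_def using finE by (intro card_mono) auto
  then have "card E' * (k - 2) + card V' \<le> card X"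
    using Suc.prems(4) Suc.hyps(2) V'(1) mult_le_mono1[of "card E'" "card E" "k - 2"] by linarith
  moreover have "sym E'" using Suc.prems(3) by (auto simp: E'_def sym_def)
  ultimately have "embeds V' E' R X"
    using V' by (intro Suc.hyps(1)) (auto simp: E'_def)
  then obtain f where f: "inj_on f V'" "f ` V' \<subseteq> X" "\<And>u v. (u, v) \<in> E' \<Longrightarrow> \<not> R (f u) (f v)"
    by (rule embedsE) (rule that)
  \<comment> \<open>\<open>E\<close> may contain loops here, so \<open>v\<close> is taken out of its
    own neighbourhood; a loop at \<open>v\<close> does no harm because \<open>R\<close> is
    irreflexive.\<close>
  define N where "N = E `` {v} - {v}"
  have N: "N \<subseteq> V'" using Suc.prems(2) by (auto simp: N_def V'_def)
  have finN: "finite N" using N V'(2) finite_subset by auto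
  have "card N \<le> card (E `` {v})"
    unfolding N_def using Suc.prems(1,2) by (intro card_mono finite_subset[OF _ Suc.prems(1)]) auto
  then have cN: "card N \<le> d" using v by simp
  show ?case
  proof (cases "\<exists>u\<in>N. h * (k - 2) < card {x \<in> X. R (f u) x}")
    case True
    then obtain u where u: "u \<in> N" "h * (k - 2) < card {x \<in> X. R (f u) x}" by auto
    have "f u \<in> X" using u(1) N f(2) by auto
    then have pf: "path_free R {x \<in> X. R (f u) x} (k - 1)" by (rule path_free_red_nbhd) simp
    have "k - 1 \<ge> 2" "k - 1 - 1 = k - 2" using k_ge by auto
    then obtain I where I: "I \<subseteq> {x \<in> X. R (f u) x}" "card I = Suc h" "\<forall>x\<in>I. \<forall>y\<in>I. \<not> R x y"
      using independent_set_exists[OF _ pf _ symp_R irreflp_R, of "Suc h"] finite_X u(2) by auto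
    have "finite I" using I(1) finite_X finite_subset by fastforce
    then show ?thesis
      using I Suc.hyps(2) Suc.prems by (intro embeds_independent[of V I]) auto
  next
    case False
    define Bad where "Bad = f ` V' \<union> (\<Union>u\<in>N. {x \<in> X. R (f u) x})"
    have "card Bad \<le> card (f ` V') + card (\<Union>u\<in>N. {x \<in> X. R (f u) x})"
      unfolding Bad_def by (rule card_Un_le)
    also have "card (f ` V') = h" using f(1) V' by (simp add: card_image)
    also have "card (\<Union>u\<in>N. {x \<in> X. R (f u) x}) \<le> (\<Sum>u\<in>N. card {x \<in> X. R (f u) x})"
      by (rule card_UN_le[OF finN])
    also have "\<dots> \<le> (\<Sum>u\<in>N. h * (k - 2))" using False by (intro sum_mono) auto
    also have "\<dots> \<le> d * (h * (k - 2))" using cN by simp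
    also have "h + d * (h * (k - 2)) < card X"
    proof -
      have "d * (h * (k - 2)) \<le> (d * Suc h) * (k - 2)" by simp
      also have "\<dots> \<le> card E * (k - 2)" using dE by (rule mult_le_mono1)
      finally show ?thesis using Suc.prems(4) Suc.hyps(2) by linarith
    qed
    finally have "card Bad < card X" by simp
    moreover have "finite Bad" using V'(2) finN finite_X by (auto simp: Bad_def)
    ultimately have "\<not> X \<subseteq> Bad" using card_mono leD by blast
    then obtain x where x: "x \<in> X" "x \<notin> Bad" by auto
    define g where "g = f(v := x)"
    have "inj_on g V"
    proof -
      have "inj_on g (insert v V')"
        using f(1) x(2) unfolding inj_on_insert by (auto simp: g_def V'_def Bad_def inj_on_def)
      moreover have "insert v V' = V" using v by (auto simp: V'_def)
      ultimately show ?thesis by simp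
    qed
    moreover have "g ` V \<subseteq> X" using f(2) x by (auto simp: g_def V'_def)
    moreover have "\<not> R (g a) (g b)" if "(a, b) \<in> E" for a b
    proof -
      have ab: "a \<in> V" "b \<in> V" "(b, a) \<in> E" using that Suc.prems(2,3) by (auto dest: symD)
      consider "a = v" "b = v" | "a = v" "b \<noteq> v" | "a \<noteq> v" "b = v" | "a \<noteq> v" "b \<noteq> v" by auto
      then show ?thesis
      proof cases
        case 1 then show ?thesis using R_irrefl by simp
      next
        case 2
        then have "b \<in> N" using that by (auto simp: N_def)
        then have "\<not> R (f b) x" using x by (auto simp: Bad_def)
        then show ?thesis using 2 R_sym by (simp add: g_def)
      next
        case 3
        then have "a \<in> N" using ab by (auto simp: N_def)
        then have "\<not> R (f a) x" using x by (auto simp: Bad_def)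
        then show ?thesis using 3 by (simp add: g_def)
      next
        case 4
        then have "(a, b) \<in> E'" using that ab by (auto simp: E'_def V'_def)
        then show ?thesis using f(3) 4 by (simp add: g_def)
      qed
    qed
    ultimately show ?thesis by (rule embedsI)
  qed
qed

text \<open>Any ordering of \<open>k\<close> vertices of a red clique is a red cycle.\<close>

lemma no_red_clique:
  assumes "K \<subseteq> X" "\<And>x y. x \<in> K \<Longrightarrow> y \<in> K \<Longrightarrow> x \<noteq> y \<Longrightarrow> R x y"
  shows "card K < k"
proof (rule ccontr)
  assume "\<not> card K < k"
  then obtain K' where K': "K' \<subseteq> K" "card K' = k"
    using obtain_subset_with_card_n[of k K] by auto
  have "K' \<subseteq> X" using K'(1) assms(1) by auto
  then have "finite K'" using finite_X by (rule finite_subset)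
  then obtain xs where xs: "set xs = K'" "distinct xs" using finite_distinct_list by blast
  have len: "length xs = k" using xs K'(2) distinct_card by fastforce
  have "successively R xs"
  proof -
    have "sorted_wrt R xs"
      unfolding sorted_wrt_iff_nth_less
    proof (intro allI impI)
      fix i j assume "i < j" "j < length xs"
      then have "xs ! i \<in> K" "xs ! j \<in> K" "xs ! i \<noteq> xs ! j"
        using xs K'(1) nth_mem[of i xs] nth_mem[of j xs] by (auto simp: nth_eq_iff_index_eq)
      then show "R (xs ! i) (xs ! j)" by (rule assms(2))
    qed
    then show ?thesis by (rule successively_if_sorted_wrt)
  qed
  moreover have "set xs \<subseteq> X" using xs K'(1) assms(1) by auto
  ultimately have "\<not> R (last xs) (hd xs)"
    using cycle_free xs(2) len by (auto simp: cycle_free_def)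
  moreover have "R (last xs) (hd xs)"
  proof (rule assms(2))
    have ne: "xs \<noteq> []" using len k_ge by auto
    then show "last xs \<in> K" "hd xs \<in> K" using xs(1) K'(1) by auto
    show "last xs \<noteq> hd xs"
      using xs(2) len k_ge ne by (auto simp: last_conv_nth hd_conv_nth nth_eq_iff_index_eq)
  qed
  ultimately show False by simp
qed

text \<open>If \<open>w\<close> cannot be inserted into the blue path, then \<open>w\<close> and the successors of its blue
  neighbours on the path form a red clique.\<close>

lemma path_insertion:
  assumes "distinct ps" "set ps \<subseteq> X" "successively B ps" "w \<in> X" "w \<notin> set ps" "ps \<noteq> []"
    and "k - 1 \<le> card {x \<in> set (butlast ps). B w x}"
  obtains ps' where "distinct ps'" "set ps' = insert w (set ps)" "successively B ps'"
    "hd ps' = hd ps" "last ps' = last ps"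
proof (rule ccontr)
  note insertion = that
  assume nt: "\<not> thesis"
  have no: False if "distinct ps'" "set ps' = insert w (set ps)" "successively B ps'"
    "hd ps' = hd ps" "last ps' = last ps" for ps'
    using insertion[OF that] nt by blast
  define I where "I = {i. Suc i < length ps \<and> B w (ps ! i)}"
  \<comment> \<open>If \<open>w\<close> were blue to the successor too, it would fit between the
    two.\<close>
  have succ_red: "R w (ps ! Suc i)" if "i \<in> I" for i
  proof (rule ccontr)
    assume *: "\<not> R w (ps ! Suc i)"
    define P Q where "P = take (Suc i) ps" and "Q = drop (Suc i) ps"
    have PQ: "ps = P @ Q" "P \<noteq> []" "Q \<noteq> []" using that by (auto simp: P_def Q_def I_def)
    have "i < length ps" "Suc i < length ps" using that by (auto simp: I_def)
    then have "last P = ps ! i" "hd Q = ps ! Suc i"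
      by (simp_all only: P_def Q_def take_Suc_conv_app_nth hd_drop_conv_nth last_snoc)
    then show False
      using no[of "P @ w # Q"] assms(1,3,5) PQ * that
      by (auto simp: successively_append_iff successively_Cons I_def R_sym)
  qed
  have succs_red: "R (ps ! Suc i) (ps ! Suc j)" if "i \<in> I" "j \<in> I" "i < j" for i j
  proof (rule ccontr)
    assume *: "\<not> R (ps ! Suc i) (ps ! Suc j)"
    \<comment> \<open>Reroute as \<open>P\<close>, \<open>w\<close>, reversed \<open>M\<close>,
      \<open>Q\<close>. The new pairs are \<open>ps ! i\<close> with \<open>w\<close>,
      \<open>w\<close> with \<open>ps ! j\<close>, and \<open>ps ! Suc i\<close> with
      \<open>ps ! Suc j\<close>, all blue; the ends stay the same.\<close>
    define P M Q where "P = take (Suc i) ps" and "M = take (j - i) (drop (Suc i) ps)"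
      and "Q = drop (Suc j) ps"
    have len: "Suc j < length ps" using that by (auto simp: I_def)
    have "drop (j - i) (drop (Suc i) ps) = Q" using that(3) by (simp add: Q_def)
    then have "drop (Suc i) ps = M @ Q"
      using append_take_drop_id[of "j - i" "drop (Suc i) ps"] by (simp add: M_def)
    then have PQ: "ps = P @ M @ Q" by (metis P_def append_take_drop_id)
    have ne: "P \<noteq> []" "M \<noteq> []" "Q \<noteq> []" using len that(3) by (auto simp: P_def M_def Q_def)
    have "i < length ps" using len that(3) by simp
    then have ends: "last P = ps ! i" "hd Q = ps ! Suc j"
      using len by (simp_all only: P_def Q_def take_Suc_conv_app_nth hd_drop_conv_nth last_snoc)
    have "hd M = ps ! Suc i" "last M = ps ! j"
      using len that(3) ne(2) by (auto simp: M_def last_conv_nth hd_conv_nth)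
    note ends = this ends
    have "successively B (P @ w # rev M @ Q)"
      using assms(3) PQ ne ends * that R_sym unfolding I_def
      by (auto simp: successively_append_iff successively_Cons hd_rev last_rev R_sym)
    moreover have "distinct (P @ w # rev M @ Q)" using assms(1,5) PQ by auto
    ultimately show False
      using no[of "P @ w # rev M @ Q"] PQ ne by auto
  qed
  define K where "K = insert w ((\<lambda>i. ps ! Suc i) ` I)"
  have finI: "finite I" by (rule finite_subset[of _ "{..<length ps}"]) (auto simp: I_def)
  have inj: "inj_on (\<lambda>i. ps ! Suc i) I"
    using assms(1) by (auto simp: inj_on_def I_def nth_eq_iff_index_eq)
  have "{x \<in> set (butlast ps). B w x} \<subseteq> (\<lambda>i. ps ! i) ` I"
    by (auto simp: I_def in_set_conv_nth nth_butlast)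
  then have "card {x \<in> set (butlast ps). B w x} \<le> card I"
    using finI surj_card_le by blast
  moreover have "w \<notin> (\<lambda>i. ps ! Suc i) ` I" using assms(5) nth_mem by (force simp: I_def)
  ultimately have "k \<le> card K"
    using inj finI assms(7) k_ge by (simp add: K_def card_image)
  moreover have "card K < k"
  proof (rule no_red_clique)
    show "K \<subseteq> X" using assms(2,4) nth_mem by (force simp: K_def I_def)
    fix x y assume xy: "x \<in> K" "y \<in> K" "x \<noteq> y"
    consider "x = w" | "y = w" | i j where "x = ps ! Suc i" "y = ps ! Suc j" "i \<in> I" "j \<in> I"
      using xy by (auto simp: K_def)
    then show "R x y"
    proof cases
      case 1
      then show ?thesis using xy succ_red by (auto simp: K_def)
    next
      case 2
      then show ?thesis using xy succ_red R_sym by (auto simp: K_def)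
    next
      case 3
      then have "i < j \<or> j < i" using xy(3) by (metis linorder_neqE_nat)
      then show ?thesis using 3 succs_red[of i j] succs_red[of j i] R_sym by metis
    qed
  qed
  ultimately show False by simp
qed

section \<open>Red cycles from almost complete red bipartite pairs\<close>

lemma common_red_neighbour:
  assumes "finite Q" "card {q \<in> Q. B w q} \<le> b" "card {q \<in> Q. B w' q} \<le> b"
    and "2 * b + length zs < card Q"
  obtains q where "q \<in> Q" "R w q" "R w' q" "q \<notin> set zs"
proof -
  let ?U = "{q \<in> Q. B w q} \<union> {q \<in> Q. B w' q} \<union> set zs"
  have "card ?U \<le> card {q \<in> Q. B w q} + card {q \<in> Q. B w' q} + card (set zs)"
    by (meson add_right_mono card_Un_le le_trans)
  also have "\<dots> < card Q" using assms(2-4) card_length[of zs] by linarith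
  finally have "card ?U < card Q" .
  then have "\<not> Q \<subseteq> ?U" using card_mono[of ?U Q] assms(1) by auto
  then show thesis using that by blast
qed

text \<open>Consecutive vertices of \<open>ws\<close> are joined through a fresh common red
  neighbour in \<open>Q\<close>: blue neighbours exclude at most \<open>2 * b\<close> candidates,
  and the path built so far excludes at most its length.\<close>

lemma alternating_path:
  assumes "finite Q" "\<And>w. w \<in> W \<Longrightarrow> card {q \<in> Q. B w q} \<le> b" "W \<inter> Q = {}"
    and "ws \<noteq> []" "distinct ws" "set ws \<subseteq> W" "2 * b + 2 * length ws \<le> card Q + 2"
  shows "\<exists>xs. distinct xs \<and> set xs \<subseteq> set ws \<union> Q \<and> successively R xs \<and> hd xs = hd ws \<and>
    last xs = last ws \<and> length xs = 2 * length ws - 1 \<and> xs \<noteq> []"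
  using assms(4-7)
proof (induction ws)
  case (Cons w ws)
  show ?case
  proof (cases "ws = []")
    case True
    then show ?thesis by (intro exI[of _ "[w]"]) auto
  next
    case False
    have "2 * b + 2 * length ws \<le> card Q + 2" using Cons.prems(4) by simp
    then obtain xs where xs: "distinct xs" "set xs \<subseteq> set ws \<union> Q" "successively R xs" "hd xs = hd ws"
      "last xs = last ws" "length xs = 2 * length ws - 1" "xs \<noteq> []"
      using Cons.IH[OF False] Cons.prems(2,3) by auto
    have "hd ws \<in> W" using False Cons.prems(3) by auto
    moreover have "w \<in> W" using Cons.prems(3) by auto
    ultimately obtain q where q: "q \<in> Q" "R w q" "R (hd ws) q" "q \<notin> set xs"
      using common_red_neighbour[OF assms(1) assms(2)[of w] assms(2)[of "hd ws"], of xs]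
        xs(6) Cons.prems(4) False by (cases ws) auto
    have "w \<notin> set xs" "w \<noteq> q" using xs(2) Cons.prems(2,3) assms(3) q(1) by auto
    then have "distinct (w # q # xs)" using xs(1) q(4) by auto
    moreover have "successively R (w # q # xs)"
      using xs(3,4,7) q R_sym by (auto simp: successively_Cons)
    ultimately show ?thesis
      using xs q(1) False by (intro exI[of _ "w # q # xs"]) (auto simp: successively_Cons)
  qed
qed simp

text \<open>An alternating path from \<open>x\<close> to \<open>y\<close> through \<open>j\<close>
  vertices of \<open>W\<close> has \<open>2 * j - 1\<close> vertices. For odd \<open>k\<close> this
  is \<open>k\<close>, and the red edge between \<open>x\<close> and \<open>y\<close> closes the
  cycle; for even \<open>k\<close> it is \<open>k - 1\<close>, and one more common red neighbour of
  \<open>x\<close> and \<open>y\<close> closes it.\<close>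

lemma dense_red_bipartite_no_edge:
  assumes "Q \<subseteq> X" "W \<subseteq> X" "W \<inter> Q = {}" "\<And>w. w \<in> W \<Longrightarrow> card {q \<in> Q. B w q} \<le> b"
    and "2 * b + k \<le> card Q" "k \<le> card W" "x \<in> W" "y \<in> W"
  shows "\<not> R x y"
proof
  assume red: "R x y"
  then have "x \<noteq> y" using R_irrefl by auto
  have fin: "finite Q" "finite W" using assms(1,2) finite_X finite_subset by auto
  define j where "j = (k + 1) div 2"
  have "card (W - {x, y}) = card W - 2" using fin assms(7,8) \<open>x \<noteq> y\<close> by simp
  then have "j - 2 \<le> card (W - {x, y})" using assms(6) k_ge by (simp add: j_def)
  then obtain Z where Z: "Z \<subseteq> W - {x, y}" "card Z = j - 2"
    using obtain_subset_with_card_n by metis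
  have "finite Z" using Z(1) fin(2) finite_subset by blast
  then obtain zs where zs: "set zs = Z" "distinct zs" using finite_distinct_list by blast
  then have len: "length zs = j - 2" using Z(2) distinct_card by fastforce
  define ws where "ws = x # zs @ [y]"
  have j2: "j \<ge> 2" using k_ge by (simp add: j_def)
  have ws: "ws \<noteq> []" "distinct ws" "set ws \<subseteq> W" "length ws = j" "hd ws = x" "last ws = y"
    using zs Z(1) len j2 \<open>x \<noteq> y\<close> assms(7,8) by (auto simp: ws_def)
  have "2 * b + 2 * length ws \<le> card Q + 2" using assms(5) ws(4) k_ge by (auto simp: j_def)
  then obtain xs where xs: "distinct xs" "set xs \<subseteq> set ws \<union> Q" "successively R xs" "hd xs = x"
      "last xs = y" "length xs = 2 * j - 1" "xs \<noteq> []"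
    using alternating_path[OF fin(1) assms(4) assms(3) ws(1-3)] ws(4-6) by auto
  have sub: "set xs \<subseteq> X" using xs(2) ws(3) assms(1,2) by auto
  show False
  proof (cases "odd k")
    case True
    then have "length xs = k" using xs(6) j_def k_ge by (auto elim!: oddE)
    then show False
      using cycle_free xs sub red R_sym unfolding cycle_free_def by metis
  next
    case False
    then have lk: "length xs = k - 1" using xs(6) j_def k_ge by (auto elim!: evenE)
    have "2 * b + length xs < card Q" using lk assms(5) k_ge by simp
    then obtain q where q: "q \<in> Q" "R x q" "R y q" "q \<notin> set xs"
      using common_red_neighbour[OF fin(1) assms(4)[OF assms(7)] assms(4)[OF assms(8)]] by metis
    have "successively R (q # xs)" using xs q R_sym by (auto simp: successively_Cons)
    moreover have "length (q # xs) = k" using lk k_ge by simp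
    moreover have "distinct (q # xs)" "set (q # xs) \<subseteq> X" using xs q sub assms(1) by auto
    ultimately have "\<not> R (last (q # xs)) (hd (q # xs))"
      using cycle_free unfolding cycle_free_def by blast
    then show False using q xs by simp
  qed
qed

end

section \<open>Blue cycles\<close>

lemma card_even_lessThan: "card {i. i < n \<and> even i} = (n + 1) div 2"
proof (induction n)
  case (Suc n)
  show ?case
  proof (cases "even n")
    case True
    have "{i. i < Suc n \<and> even i} = insert n {i. i < n \<and> even i}"
      using True by (auto simp: less_Suc_eq)
    then show ?thesis using Suc True by simp
  next
    case False
    have "{i. i < Suc n \<and> even i} = {i. i < n \<and> even i}"
      using False by (auto simp: less_Suc_eq)
    then show ?thesis using Suc False by simp
  qed
qed simp

lemma card_odd_lessThan: "card {i. i < n \<and> odd i} = n div 2"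
proof -
  have "{..<n} = {i. i < n \<and> even i} \<union> {i. i < n \<and> odd i}" by auto
  then have "n = card {i. i < n \<and> even i} + card {i. i < n \<and> odd i}"
    using card_Un_disjoint[of "{i. i < n \<and> even i}" "{i. i < n \<and> odd i}"] card_lessThan[of n]
    by auto
  then show ?thesis unfolding card_even_lessThan by (cases "even n") (auto elim!: evenE oddE)
qed

context cycle_free_host
begin

definition has_blue_cycle :: "'b set \<Rightarrow> nat \<Rightarrow> bool" where
  "has_blue_cycle W c \<longleftrightarrow> (\<exists>xs. distinct xs \<and> set xs \<subseteq> W \<and> successively B xs \<and>
     B (last xs) (hd xs) \<and> length xs = c)"

text \<open>The cycle is coloured by the parity of the index. Only the closing edge, for odd
  \<open>c\<close>, stays inside a class, so \<open>A0\<close> has at most two vertices; the side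
  hosting it is padded to \<open>k - 1\<close> so that it contains a blue pair.\<close>

lemma has_blue_cycle_if_path_free:
  assumes "W \<subseteq> X" "path_free R W (k - 1)" "3 \<le> c"
    and "max ((c + 1) div 2) (k - 1) + c div 2 + (k - 3) \<le> card W"
  shows "has_blue_cycle W c"
proof -
  \<comment> \<open>Each edge is listed in one direction only, which suffices because
    \<open>R\<close> is symmetric.\<close>
  define E where "E = insert (c - 1, 0) {(i, Suc i) | i. Suc i < c}"
  define A where "A = {i. i < c \<and> even i}"
  define A0 where "A0 = A \<inter> {0, c - 1}"
  have finW: "finite W" using assms(1) finite_X by (rule finite_subset)
  have "card A0 \<le> card {0, c - 1}" unfolding A0_def by (intro card_mono) auto
  also have "\<dots> \<le> 2" by (simp add: card_insert_if)
  finally have "(card A0 - 1) * (k - 1 - 1) \<le> 1 * (k - 1 - 1)" by (intro mult_le_mono1) simp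
  also have "\<dots> < max ((c + 1) div 2) (k - 1)" using k_ge by simp
  finally have A0: "(card A0 - 1) * (k - 1 - 1) < max ((c + 1) div 2) (k - 1)" .
  have "embeds {..<c} E R W"
  proof (rule embeds_almost_bipartite[OF finW assms(2) _ symp_R irreflp_R,
        where A = A and B = "{i. i < c \<and> odd i}" and ?A0.0 = A0 and ?B0.0 = "{}"
          and a = "max ((c + 1) div 2) (k - 1)" and b = "c div 2"])
    show "2 \<le> k - 1" using k_ge by simp
    show "E \<subseteq> {..<c} \<times> {..<c}" using assms(3) by (auto simp: E_def)
    show "{..<c} = A \<union> {i. i < c \<and> odd i}" by (auto simp: A_def)
    show "u \<in> A0 \<and> v \<in> A0" if "(u, v) \<in> E" "u \<in> A" "v \<in> A" for u v
      using that by (auto simp: E_def A_def A0_def)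
    show "u \<in> {} \<and> v \<in> {}" if "(u, v) \<in> E" "u \<in> {i. i < c \<and> odd i}" "v \<in> {i. i < c \<and> odd i}" for u v
      using that by (auto simp: E_def)
    show "card A \<le> max ((c + 1) div 2) (k - 1)" unfolding A_def card_even_lessThan by simp
    show "card {i. i < c \<and> odd i} \<le> c div 2" unfolding card_odd_lessThan by simp
    have "k - 1 - 2 = k - 3" by simp
    then show "max ((c + 1) div 2) (k - 1) + c div 2 + (k - 1 - 2) \<le> card W"
      using assms(4) by (simp only:)
    show "finite {..<c}" by (rule finite_lessThan)
    show "A \<inter> {i. i < c \<and> odd i} = {}" unfolding A_def by blast
    show "A0 \<subseteq> A" unfolding A0_def by blast
    show "{} \<subseteq> {i. i < c \<and> odd i}" by (rule empty_subsetI)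
    show "A0 = {} \<or> (card A0 - 1) * (k - 1 - 1) < max ((c + 1) div 2) (k - 1)"
      using A0 by (rule disjI2)
    show "{} = {} \<or> (card {} - 1) * (k - 1 - 1) < c div 2" by (intro disjI1 refl)
  qed
  then obtain f where f: "inj_on f {..<c}" "f ` {..<c} \<subseteq> W" "\<And>u v. (u, v) \<in> E \<Longrightarrow> \<not> R (f u) (f v)"
    by (rule embedsE) (rule that)
  define xs where "xs = map f [0..<c]"
  have ne: "[0..<c] \<noteq> []" using assms(3) by simp
  have "distinct xs" using f(1) by (simp add: xs_def distinct_map lessThan_atLeast0)
  moreover have "set xs \<subseteq> W" using f(2) by (auto simp: xs_def)
  moreover have "successively B xs"
  proof -
    have "successively (\<lambda>x y. B (f x) (f y)) [0..<m]" if "m \<le> c" for m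
      using that
    proof (induction m)
      case (Suc m)
      then show ?case
        by (cases m) (auto simp: successively_append_iff E_def intro!: f(3))
    qed simp
    then show ?thesis by (simp add: xs_def successively_map)
  qed
  moreover have "last xs = f (c - 1)" "hd xs = f 0"
    using assms(3) ne by (auto simp: xs_def last_map hd_map)
  then have "B (last xs) (hd xs)" using f(3) by (auto simp: E_def)
  ultimately show ?thesis unfolding has_blue_cycle_def by (intro exI[of _ xs]) (simp add: xs_def)
qed

text \<open>The degree bound is what remains when \<open>has_blue_cycle_if_path_free\<close> fails
  for \<open>c = 3\<close> in every red neighbourhood: there the required size is
  \<open>(k - 1) + 1 + (k - 3)\<close>. With it, any two vertices have a common blue
  neighbour.\<close>

lemma has_blue_cycle_triangle:
  assumes "7 * k \<le> card X" "\<And>v. v \<in> X \<Longrightarrow> card {x \<in> X. R v x} \<le> 2 * k - 4"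
  shows "has_blue_cycle X 3"
proof -
  have pick: "\<exists>x \<in> X. x \<notin> {u, v} \<and> B u x \<and> B v x" if "u \<in> X" "v \<in> X" for u v
  proof -
    let ?U = "{u, v} \<union> {x \<in> X. R u x} \<union> {x \<in> X. R v x}"
    have "card ?U \<le> card {u, v} + card {x \<in> X. R u x} + card {x \<in> X. R v x}"
      by (meson add_right_mono card_Un_le le_trans)
    also have "\<dots> \<le> 2 + (2 * k - 4) + (2 * k - 4)"
      using assms(2)[OF that(1)] assms(2)[OF that(2)] by (intro add_mono) (auto simp: card_insert_if)
    also have "\<dots> < card X" using assms(1) k_ge by linarith
    finally have "\<not> X \<subseteq> ?U" using finite_X card_mono[of ?U X] by auto
    then show ?thesis by blast
  qed
  have "X \<noteq> {}" using assms(1) k_ge by auto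
  then obtain u where u: "u \<in> X" by auto
  obtain v where v: "v \<in> X" "v \<noteq> u" "B u v" using pick[OF u u] by auto
  obtain x where x: "x \<in> X" "x \<notin> {u, v}" "B u x" "B v x" using pick[OF u v(1)] by auto
  show ?thesis
    unfolding has_blue_cycle_def
    using u v x R_sym by (intro exI[of _ "[u, v, x]"]) auto
qed

text \<open>A vertex outside the cycle is red to almost all of it, so it has few red neighbours outside.
  Hence any two outside vertices have a common blue neighbour outside, and two consecutive cycle
  vertices can be replaced by a blue path on three outside vertices.\<close>

lemma has_blue_cycle_step:
  assumes "3 * k + 1 \<le> n" "2 * n + k - 2 \<le> card X" "4 \<le> c" "c \<le> n"
    and "has_blue_cycle X (c - 1)"
  shows "has_blue_cycle X c"
proof (rule ccontr)
  assume no: "\<not> has_blue_cycle X c"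
  \<comment> \<open>\<open>a\<close> and \<open>b\<close> are the side sizes of
    \<open>has_blue_cycle_if_path_free\<close>: a red neighbourhood with
    \<open>a + b + (k - 3)\<close> vertices already contains a blue cycle of length
    \<open>c\<close>.\<close>
  define a b where "a = max ((c + 1) div 2) (k - 1)" and "b = c div 2"
  have ab: "a + b = c \<or> a = k - 1 \<and> c \<le> 2 * k - 2" "b + b \<le> c" "a \<ge> k - 1"
    using k_ge by (auto simp: a_def b_def max_def)
  \<comment> \<open>The first inequality provides a common blue neighbour outside the cycle
    (\<open>common\<close>), the second provides two blue neighbours outside (\<open>two\<close>),
    so that \<open>w\<close> and \<open>w'\<close> can be chosen distinct.\<close>
  have "2 * a + 2 * b + 3 * k \<le> 2 * n + c + 4 \<and> a + b + c \<le> 2 * n + 1"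
    using ab(1)
  proof
    assume "a + b = c"
    then show ?thesis using assms(1,4) by simp
  next
    assume "a = k - 1 \<and> c \<le> 2 * k - 2"
    then show ?thesis using ab(2) assms(1) k_ge by auto
  qed
  then have size1: "2 * a + 2 * b + 3 * k \<le> 2 * n + c + 4" and size2: "a + b + c \<le> 2 * n + 1"
    by simp_all
  obtain xs where xs: "distinct xs" "set xs \<subseteq> X" "successively B xs" "B (last xs) (hd xs)"
    "length xs = c - 1"
    using assms(5) by (auto simp: has_blue_cycle_def)
  define W where "W = X - set xs"
  have "card W = card X - (c - 1)" "c - 1 \<le> card X"
    using xs finite_X card_mono[OF finite_X xs(2)]
    by (auto simp: W_def card_Diff_subset distinct_card)
  then have cW: "2 * n + k \<le> card W + c + 1" using assms(2,3) by linarith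
  have red: "card {x \<in> X. R v x} + 4 \<le> a + b + k" if "v \<in> X" for v
  proof (rule ccontr)
    assume "\<not> ?thesis"
    then have "a + b + (k - 3) \<le> card {x \<in> X. R v x}" using k_ge ab by linarith
    then have "has_blue_cycle {x \<in> X. R v x} c"
      using path_free_red_nbhd[OF that, of "{x \<in> X. R v x}"] assms(3)
      by (intro has_blue_cycle_if_path_free) (auto simp: a_def b_def)
    then show False using no unfolding has_blue_cycle_def by blast
  qed
  have few: "card {x \<in> W. R w x} + c + 4 \<le> a + b + 2 * k" if w: "w \<in> W" for w
  proof -
    \<comment> \<open>Otherwise \<open>w\<close> could be inserted into the cycle read as a path.
      The ends are preserved, so the closing pair stays blue and the length becomes
      \<open>c\<close>.\<close>
    have "card {x \<in> set (butlast xs). B w x} < k - 1"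
    proof (rule ccontr)
      assume "\<not> ?thesis"
      then have le: "k - 1 \<le> card {x \<in> set (butlast xs). B w x}" by simp
      have "w \<in> X" "w \<notin> set xs" "xs \<noteq> []" using w xs(5) assms(3) by (auto simp: W_def)
      then obtain ps where ps: "distinct ps" "set ps = insert w (set xs)" "successively B ps"
        "hd ps = hd xs" "last ps = last xs"
        using path_insertion[OF xs(1,2,3) _ _ _ le] by metis
      have "length ps = c"
        using ps xs \<open>w \<notin> set xs\<close> assms(3) distinct_card[of ps] distinct_card[of xs] by simp
      then show False
        using no ps xs \<open>w \<in> X\<close> unfolding has_blue_cycle_def by (metis insert_subset)
    qed
    moreover have "card (set (butlast xs)) = c - 2"
      using xs by (simp add: distinct_butlast distinct_card)
    moreover have "set (butlast xs) = {x \<in> set (butlast xs). B w x} \<union> {x \<in> set (butlast xs). R w x}"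
      by auto
    then have "card (set (butlast xs)) \<le> card {x \<in> set (butlast xs). B w x} + card {x \<in> set (butlast xs). R w x}"
      by (rule ord_eq_le_trans[OF arg_cong[where f = card] card_Un_le])
    ultimately have "c \<le> k + card {x \<in> set (butlast xs). R w x}" by linarith
    moreover have "card {x \<in> W. R w x} + card {x \<in> set (butlast xs). R w x} \<le> card {x \<in> X. R w x}"
    proof -
      have "card {x \<in> W. R w x} + card {x \<in> set (butlast xs). R w x} =
          card ({x \<in> W. R w x} \<union> {x \<in> set (butlast xs). R w x})"
        using finite_X by (intro card_Un_disjoint[symmetric]) (auto simp: W_def dest: in_set_butlastD)
      also have "\<dots> \<le> card {x \<in> X. R w x}"
        using finite_X xs(2) by (intro card_mono) (auto simp: W_def dest: in_set_butlastD)
      finally show ?thesis .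
    qed
    moreover have "card {x \<in> X. R w x} + 4 \<le> a + b + k" using red w by (auto simp: W_def)
    ultimately show ?thesis by linarith
  qed
  have finW: "finite W" using finite_X by (simp add: W_def)
  have common: "\<exists>x \<in> W. x \<notin> {w, w'} \<and> B w x \<and> B w' x" if "w \<in> W" "w' \<in> W" for w w'
  proof -
    let ?U = "{w, w'} \<union> {x \<in> W. R w x} \<union> {x \<in> W. R w' x}"
    have "card ?U \<le> card {w, w'} + card {x \<in> W. R w x} + card {x \<in> W. R w' x}"
      by (meson add_right_mono card_Un_le le_trans)
    moreover have "card {w, w'} \<le> 2" by (simp add: card_insert_if)
    ultimately have "card ?U < card W"
      using few[OF that(1)] few[OF that(2)] cW size1 by linarith
    then have "\<not> W \<subseteq> ?U" using finW card_mono[of ?U W] by auto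
    then show ?thesis by blast
  qed
  have two: "2 \<le> card {x \<in> W. B q x}" if "q \<in> X" for q
  proof -
    have "W = {x \<in> W. B q x} \<union> {x \<in> W. R q x}" by auto
    then have "card W \<le> card {x \<in> W. B q x} + card {x \<in> W. R q x}"
      by (rule ord_eq_le_trans[OF arg_cong[where f = card] card_Un_le])
    moreover have "card {x \<in> W. R q x} \<le> card {x \<in> X. R q x}"
      using finite_X by (intro card_mono) (auto simp: W_def)
    ultimately show ?thesis using red[OF that] cW size2 by linarith
  qed
  define ys where "ys = take (c - 3) xs"
  have ys: "ys \<noteq> []" "length ys = c - 3" "distinct ys" "set ys \<subseteq> set xs" "successively B ys"
  proof -
    show "ys \<noteq> []" "length ys = c - 3" "distinct ys" "set ys \<subseteq> set xs"
      using xs assms(3) by (auto simp: ys_def dest: in_set_takeD)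
    have "successively B (ys @ drop (c - 3) xs)" using xs(3) by (simp add: ys_def)
    then show "successively B ys" by (simp only: successively_append_iff)
  qed
  have "hd ys \<in> X" "last ys \<in> X" using ys xs(2) hd_in_set last_in_set by blast+
  have "{x \<in> W. B (hd ys) x} \<noteq> {}" using two[OF \<open>hd ys \<in> X\<close>] by (metis card.empty not_numeral_le_zero)
  then obtain w where w: "w \<in> W" "B (hd ys) w" by auto
  have "{x \<in> W. B (last ys) x} - {w} \<noteq> {}"
  proof
    assume "{x \<in> W. B (last ys) x} - {w} = {}"
    then have "card {x \<in> W. B (last ys) x} \<le> card {w}" by (intro card_mono) auto
    then show False using two[OF \<open>last ys \<in> X\<close>] by simp
  qed
  then obtain w' where w': "w' \<in> W" "B (last ys) w'" "w' \<noteq> w" by auto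
  obtain x where x: "x \<in> W" "x \<noteq> w" "x \<noteq> w'" "B w x" "B w' x" using common[OF w(1) w'(1)] by auto
  have "has_blue_cycle X c"
    unfolding has_blue_cycle_def
  proof (intro exI conjI)
    show "distinct (ys @ [w', x, w])" using ys w w' x by (auto simp: W_def)
    show "set (ys @ [w', x, w]) \<subseteq> X" using ys w w' x xs(2) by (auto simp: W_def)
    show "successively B (ys @ [w', x, w])"
      using ys w w' x R_sym by (auto simp: successively_append_iff)
    show "B (last (ys @ [w', x, w])) (hd (ys @ [w', x, w]))" using ys(1) w R_sym by auto
    show "length (ys @ [w', x, w]) = c" using ys(2) assms(3) by simp
  qed
  then show False using no by simp
qed

text \<open>Every length up to \<open>n\<close> is wanted because stripping the leaves of a
  unicyclic graph may leave a cycle of any length.\<close>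

lemma has_blue_cycle_all_lengths:
  assumes "3 * k + 1 \<le> n" "2 * n + k - 2 \<le> card X" "3 \<le> c" "c \<le> n"
  shows "has_blue_cycle X c"
  using assms(3,4)
proof (induction c rule: nat_induct_at_least)
  case base
  show ?case
  proof (rule ccontr)
    assume no: "\<not> has_blue_cycle X 3"
    have "card {x \<in> X. R v x} \<le> 2 * k - 4" if "v \<in> X" for v
    proof (rule ccontr)
      assume "\<not> ?thesis"
      then have "has_blue_cycle {x \<in> X. R v x} 3"
        using path_free_red_nbhd[OF that, of "{x \<in> X. R v x}"] k_ge
        by (intro has_blue_cycle_if_path_free) auto
      then show False using no unfolding has_blue_cycle_def by blast
    qed
    then have "has_blue_cycle X 3" using assms(1,2) by (intro has_blue_cycle_triangle) auto
    then show False using no by simp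
  qed
next
  case (Suc c)
  then show ?case using has_blue_cycle_step[OF assms(1,2), of "Suc c"] by simp
qed

end

section \<open>Breadth-first trees\<close>

text \<open>Connectivity is stated by cuts, which makes it easy to check after deleting a leaf or
  shortening a path. Edges are counted as arcs, that is, twice.\<close>

locale conn_graph =
  fixes V :: "'a set" and E :: "'a rel"
  assumes finite_V: "finite V" and V_ne: "V \<noteq> {}" and E_sub: "E \<subseteq> V \<times> V"
    and E_sym: "sym E" and E_irrefl: "(v, v) \<notin> E"
    and cut: "S \<subseteq> V \<Longrightarrow> S \<noteq> {} \<Longrightarrow> S \<noteq> V \<Longrightarrow> \<exists>u\<in>S. \<exists>v\<in>V - S. (u, v) \<in> E"
begin

lemma in_V: "(u, v) \<in> E \<Longrightarrow> u \<in> V" "(u, v) \<in> E \<Longrightarrow> v \<in> V"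
  using E_sub by auto

lemma E_symD: "(u, v) \<in> E \<Longrightarrow> (v, u) \<in> E"
  using E_sym by (rule symD)

lemma finite_E: "finite E"
  using E_sub finite_V by (meson finite_SigmaI finite_subset)

lemma reachable:
  assumes "r \<in> V" "v \<in> V"
  shows "\<exists>i. (r, v) \<in> E ^^ i"
proof -
  define S where "S = {v \<in> V. \<exists>i. (r, v) \<in> E ^^ i}"
  have "(r, r) \<in> E ^^ 0" by simp
  then have "r \<in> S" unfolding S_def using assms(1) by blast
  have "S = V"
  proof (rule ccontr)
    assume "S \<noteq> V"
    moreover have "S \<subseteq> V" by (auto simp: S_def)
    ultimately obtain u w where uw: "u \<in> S" "w \<in> V - S" "(u, w) \<in> E"
      using cut[of S] \<open>r \<in> S\<close> by blast
    then obtain i where "(r, u) \<in> E ^^ i" by (auto simp: S_def)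
    then have "(r, w) \<in> E ^^ Suc i" using uw(3) by auto
    then show False using uw(2) by (auto simp: S_def simp del: relpow.simps)
  qed
  then show ?thesis using assms(2) by (auto simp: S_def)
qed

end

text \<open>The convention \<open>par r = r\<close> lets iterates of \<open>par\<close> rest at the
  root, which matches truncated subtraction of levels in \<open>par_funpow\<close>.\<close>

locale bfs_graph = conn_graph V E for V :: "'a set" and E :: "'a rel" +
  fixes r :: 'a and d :: "'a \<Rightarrow> nat" and par :: "'a \<Rightarrow> 'a"
  assumes r_in: "r \<in> V" and par_r: "par r = r" and d_r: "d r = 0"
    and d_zero: "v \<in> V \<Longrightarrow> d v = 0 \<Longrightarrow> v = r"
    and par_arc: "v \<in> V \<Longrightarrow> v \<noteq> r \<Longrightarrow> (v, par v) \<in> E"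
    and d_par: "v \<in> V \<Longrightarrow> v \<noteq> r \<Longrightarrow> d v = Suc (d (par v))"
    and d_arc: "(u, v) \<in> E \<Longrightarrow> d v \<le> Suc (d u)"

lemma (in conn_graph) bfs_graph_exists: "\<exists>r d par. bfs_graph V E r d par"
proof -
  obtain r where r: "r \<in> V" using V_ne by auto
  define d where "d v = (LEAST i. (r, v) \<in> E ^^ i)" for v
  have dI: "(r, v) \<in> E ^^ d v" if "v \<in> V" for v
    unfolding d_def using reachable[OF r that] by (rule LeastI_ex)
  have dle: "d v \<le> i" if "(r, v) \<in> E ^^ i" for v i
    unfolding d_def using that by (rule Least_le)
  have arc: "d v \<le> Suc (d u)" if "(u, v) \<in> E" for u v
    using dI[OF in_V(1)[OF that]] that by (intro dle) auto
  have zero: "v = r" if "v \<in> V" "d v = 0" for v using dI[OF that(1)] that(2) by simp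
  have "\<exists>u. (v, u) \<in> E \<and> d v = Suc (d u)" if "v \<in> V" "v \<noteq> r" for v
  proof -
    have "d v \<noteq> 0" using zero[OF that(1)] that(2) by blast
    then obtain i where i: "d v = Suc i" using not0_implies_Suc by blast
    then have "(r, v) \<in> E ^^ Suc i" using dI that by metis
    then obtain u where u: "(r, u) \<in> E ^^ i" "(u, v) \<in> E" by auto
    then have "d u \<le> i" "d v \<le> Suc (d u)" using dle arc by auto
    then show ?thesis using i u(2) E_symD by (intro exI[of _ u]) auto
  qed
  then obtain p where p: "\<And>v. v \<in> V \<Longrightarrow> v \<noteq> r \<Longrightarrow> (v, p v) \<in> E \<and> d v = Suc (d (p v))"
    by metis
  have "d r = 0" using dle[of r 0] by simp
  have "bfs_graph V E r d (p(r := r))"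
  proof unfold_locales
    show "(v, (p(r := r)) v) \<in> E" if "v \<in> V" "v \<noteq> r" for v
      using p[OF that] that(2) by simp
    show "d v = Suc (d ((p(r := r)) v))" if "v \<in> V" "v \<noteq> r" for v
      by (subst fun_upd_other[OF that(2)]) (rule conjunct2[OF p[OF that]])
    show "(p(r := r)) r = r" by simp
  qed (fact r \<open>d r = 0\<close> zero arc)+
  then show ?thesis by (intro exI)
qed

context bfs_graph
begin

text \<open>Both orientations of every tree edge are removed, so the cardinality is twice the excess
  over a spanning tree.\<close>

definition nontree :: "'a rel" where
  "nontree = E - (\<lambda>v. (v, par v)) ` (V - {r}) - (\<lambda>v. (par v, v)) ` (V - {r})"

lemma card_nontree: "card nontree + 2 * (card V - 1) = card E"
proof -
  let ?T = "(\<lambda>v. (v, par v)) ` (V - {r})" and ?T' = "(\<lambda>v. (par v, v)) ` (V - {r})"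
  have sub: "?T \<subseteq> E" "?T' \<subseteq> E" using par_arc E_symD by auto
  have disj: "?T \<inter> ?T' = {}"
  proof (rule ccontr)
    assume "?T \<inter> ?T' \<noteq> {}"
    then obtain v w where "v \<in> V - {r}" "w \<in> V - {r}" "v = par w" "par v = w" by auto
    then show False using d_par[of v] d_par[of w] by auto
  qed
  have "card ?T = card V - 1" "card ?T' = card V - 1"
    using finite_V r_in by (auto simp: card_image inj_on_def)
  then have "card (?T \<union> ?T') = 2 * (card V - 1)"
    using disj finite_V by (simp add: card_Un_disjoint)
  moreover have "nontree = E - (?T \<union> ?T')" by (auto simp: nontree_def)
  moreover have "card (E - (?T \<union> ?T')) = card E - card (?T \<union> ?T')"
    using sub finite_V by (intro card_Diff_subset) auto
  moreover have "card (?T \<union> ?T') \<le> card E" using sub finite_E by (intro card_mono) auto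
  ultimately show ?thesis by simp
qed

lemma sym_nontree: "(u, v) \<in> nontree \<Longrightarrow> (v, u) \<in> nontree"
  using E_symD by (auto simp: nontree_def)

lemma arc_cases:
  assumes "(u, v) \<in> E"
  obtains "(u, v) \<in> nontree" | "u \<noteq> r" "v = par u" | "v \<noteq> r" "u = par v"
  using assms in_V[OF assms] by (cases "(u, v) \<in> nontree") (auto simp: nontree_def)

text \<open>Tree arcs change the parity of the level, and arcs never skip a level. Hence the only
  defects of the parity colouring are nontree edges inside one level.\<close>

lemma same_parity:
  assumes "(u, v) \<in> E" "even (d u) \<longleftrightarrow> even (d v)"
  shows "(u, v) \<in> nontree" "d u = d v"
proof -
  show "(u, v) \<in> nontree"
    using assms(1)
  proof (cases rule: arc_cases)
    case 2
    then show ?thesis using d_par[of u] in_V[OF assms(1)] assms(2) by auto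
  next
    case 3
    then show ?thesis using d_par[of v] in_V[OF assms(1)] assms(2) by auto
  qed
  have "d u \<le> Suc (d v)" "d v \<le> Suc (d u)" using d_arc E_symD assms(1) by auto
  then have "d u = d v \<or> d u = Suc (d v) \<or> d v = Suc (d u)" by linarith
  then show "d u = d v" using assms(2) by auto
qed

lemma par_funpow:
  assumes "v \<in> V"
  shows "(par ^^ i) v \<in> V \<and> d ((par ^^ i) v) = d v - i"
proof (induction i)
  case (Suc i)
  let ?w = "(par ^^ i) v"
  show ?case
  proof (cases "?w = r")
    case True
    then show ?thesis using Suc par_r d_r by simp
  next
    case False
    then show ?thesis using Suc par_arc[of ?w] d_par[of ?w] in_V by fastforce
  qed
qed (use assms in simp)

text \<open>The subtree rooted at \<open>x\<close>, with \<open>x\<close> included. Exchanging the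
  two colours on it affects, among the tree edges, only the one from \<open>x\<close> to its
  parent.\<close>

definition desc :: "'a \<Rightarrow> 'a set" where "desc x = {v. \<exists>i. (par ^^ i) v = x}"

lemma desc_self: "x \<in> desc x"
  unfolding desc_def by (simp add: exI[of _ 0])

lemma desc_par: "v \<noteq> x \<Longrightarrow> v \<in> desc x \<longleftrightarrow> par v \<in> desc x"
proof
  assume "v \<noteq> x" "v \<in> desc x"
  then obtain i where i: "(par ^^ i) v = x" by (auto simp: desc_def)
  then obtain j where "i = Suc j" using \<open>v \<noteq> x\<close> by (cases i) auto
  then have "(par ^^ j) (par v) = x" using i by (simp add: funpow_swap1)
  then show "par v \<in> desc x" by (auto simp: desc_def)
next
  assume "par v \<in> desc x"
  then obtain i where "(par ^^ i) (par v) = x" by (auto simp: desc_def)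
  then have "(par ^^ Suc i) v = x" by (simp add: funpow_swap1)
  then show "v \<in> desc x" unfolding desc_def by blast
qed

lemma par_notin_desc:
  assumes "x \<in> V" "x \<noteq> r"
  shows "par x \<notin> desc x"
proof
  assume "par x \<in> desc x"
  then obtain i where "(par ^^ i) (par x) = x" by (auto simp: desc_def)
  then have "d x = d (par x) - i" using par_funpow[of "par x" i] par_arc[OF assms] in_V by auto
  then show False using d_par[OF assms] by simp
qed

text \<open>Both \<open>x\<close> and \<open>y\<close> are the ancestor of \<open>v\<close> on the
  same level. That level is positive, so truncated subtraction still determines the number of
  \<open>par\<close> steps.\<close>

lemma desc_disjoint:
  assumes "v \<in> V" "v \<in> desc x" "v \<in> desc y" "d x = d y" "d x > 0"
  shows "x = y"
proof -
  obtain i j where ij: "(par ^^ i) v = x" "(par ^^ j) v = y" using assms(2,3) by (auto simp: desc_def)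
  then have "d x = d v - i" "d y = d v - j" using par_funpow[OF assms(1)] by auto
  then have "i = j" using assms(4,5) by simp
  then show ?thesis using ij by simp
qed

end

text \<open>\<open>L\<close> consists of leaves attached to \<open>S\<close>. A subset \<open>Z\<close> of \<open>S\<close> carrying enough leaves trades
  places with the rest of \<open>S\<close>: the two colour classes are \<open>Z\<close> with the leaves of \<open>S - Z\<close>, and
  \<open>S - Z\<close> with the leaves of \<open>Z\<close>. If \<open>Z\<close> is minimal, then either \<open>S - Z\<close> carries enough
  leaves as well, or \<open>Z\<close> is a single vertex and its class is independent.\<close>

lemma embeds_hubs_with_leaves:
  assumes "finite W" "path_free R W (k - 1)" "k \<ge> 3" "symp R" "irreflp R"
    and "finite V" "E \<subseteq> V \<times> V" "\<And>v. (v, v) \<notin> E" "sym E" "S \<subseteq> V" "S \<noteq> {}"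
    and leaf: "\<And>u v. (u, v) \<in> E \<Longrightarrow> u \<in> V - S \<Longrightarrow> v = p u" and p: "\<And>u. u \<in> V - S \<Longrightarrow> p u \<in> S"
    and "card S * (3 * k - 5) \<le> card V" "card V + (k - 3) \<le> card W"
  shows "embeds V E R W"
proof -
  define s where "s = card S"
  \<comment> \<open>A side with at least \<open>t\<close> vertices contains a red-independent set of
    any size up to \<open>s\<close>. Since \<open>3 * k - 5 = 3 * (k - 2) + 1\<close>, there are at
    least \<open>3 * t\<close> leaves.\<close>
  define t where "t = s * (k - 2)"
  define lv where "lv Z = {v \<in> V - S. p v \<in> Z}" for Z
  have finS: "finite S" using assms(6,10) finite_subset by auto
  have finlv: "finite (lv Z)" for Z using assms(6) by (simp add: lv_def)
  have cV: "card (V - S) = card V - s" "s \<le> card V"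
    using assms(6,10) finS by (auto simp: s_def card_Diff_subset card_mono)
  have "3 * k - 5 = 3 * (k - 2) + 1" using assms(3) by simp
  then have big: "3 * t + s \<le> card V" using assms(14) by (simp add: t_def s_def algebra_simps)
  have "s \<ge> 1" using finS assms(11) by (simp add: s_def Suc_le_eq card_gt_0_iff)
  have "lv S = V - S" using p by (auto simp: lv_def)
  then have "t \<le> card (lv S)" using cV big by simp
  define Q where "Q Z \<longleftrightarrow> Z \<subseteq> S \<and> t \<le> card (lv Z)" for Z
  define Z where "Z = (ARG_MIN card Z. Q Z)"
  have "Q S" using \<open>t \<le> card (lv S)\<close> by (simp add: Q_def)
  then have QZ: "Q Z" and minZ: "\<And>Z'. Q Z' \<Longrightarrow> card Z \<le> card Z'"
    unfolding Z_def using arg_min_nat_lemma[of Q S card] by auto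
  have Z: "Z \<subseteq> S" "t \<le> card (lv Z)" using QZ by (auto simp: Q_def)
  have finZ: "finite Z" using Z(1) finS by (rule finite_subset)
  have split: "card (lv Z) + card (lv (S - Z)) = card V - s"
  proof -
    have "lv Z \<union> lv (S - Z) = V - S" "lv Z \<inter> lv (S - Z) = {}" using p by (auto simp: lv_def)
    then show ?thesis using card_Un_disjoint[OF finlv finlv, of Z "S - Z"] cV by simp
  qed
  \<comment> \<open>By minimality both \<open>Z - {z}\<close> and \<open>{z}\<close> carry fewer
    than \<open>t\<close> leaves, so \<open>Z\<close> carries fewer than \<open>2 * t\<close> of
    them, and at least \<open>t\<close> remain for \<open>S - Z\<close>.\<close>
  have many: "t \<le> card (lv (S - Z))" if "card Z \<noteq> 0" "card Z \<noteq> 1"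
  proof -
    have "Z \<noteq> {}" using that(1) by auto
    then obtain z where z: "z \<in> Z" by auto
    have "card (Z - {z}) < card Z" using z finZ by (meson card_Diff1_less)
    then have "\<not> Q (Z - {z})" "\<not> Q {z}" using minZ that by fastforce+
    then have "card (lv (Z - {z})) < t" "card (lv {z}) < t" using Z(1) z by (auto simp: Q_def)
    moreover have "lv Z = lv (Z - {z}) \<union> lv {z}" using z by (auto simp: lv_def)
    then have "card (lv Z) \<le> card (lv (Z - {z})) + card (lv {z})" by (metis card_Un_le)
    ultimately show ?thesis using split big by linarith
  qed
  have small: "(card Y - 1) * (k - 1 - 1) < t" if "Y \<subseteq> S" for Y
  proof -
    have "card Y - 1 < s" using card_mono[OF finS that] \<open>s \<ge> 1\<close> by (simp add: s_def)
    then show ?thesis using assms(3) unfolding t_def by (simp add: numeral_2_eq_2)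
  qed
  \<comment> \<open>A single hub spans no edge, so no independent set has to be reserved for
    it.\<close>
  define B0 where "B0 = (if card Z \<le> 1 then {} else Z)"
  define A where "A = (S - Z) \<union> lv Z"
  define C where "C = Z \<union> lv (S - Z)"
  have noloop: False if "(u, v) \<in> E" "u \<in> Z" "v \<in> Z" "card Z \<le> 1" for u v
  proof -
    have "u = v" using that finZ by (metis card_le_Suc0_iff_eq One_nat_def)
    then show False using that(1) assms(8) by auto
  qed
  have inA: "u \<in> S - Z" if "(u, v) \<in> E" "u \<in> A" "v \<in> A" for u v
  proof (rule ccontr)
    assume "u \<notin> S - Z"
    then have "u \<in> V - S" "p u \<in> Z" using that(2) by (auto simp: A_def lv_def)
    then have "v \<in> Z" using leaf[OF that(1)] by simp
    then show False using that(3) Z(1) by (auto simp: A_def lv_def)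
  qed
  have inC: "u \<in> Z" if "(u, v) \<in> E" "u \<in> C" "v \<in> C" for u v
  proof (rule ccontr)
    assume "u \<notin> Z"
    then have "u \<in> V - S" "p u \<in> S - Z" using that(2) by (auto simp: C_def lv_def)
    then have "v \<in> S - Z" using leaf[OF that(1)] by simp
    then show False using that(3) by (auto simp: C_def lv_def)
  qed
  show ?thesis
  proof (rule embeds_almost_bipartite[OF assms(1,2) _ assms(4-7),
        where A = A and B = C and ?A0.0 = "S - Z" and ?B0.0 = B0 and a = "card A" and b = "card C"])
    show "2 \<le> k - 1" using assms(3) by simp
    show VAC: "V = A \<union> C" using p assms(10) Z(1) by (auto simp: A_def C_def lv_def)
    show AC: "A \<inter> C = {}" using Z(1) by (auto simp: A_def C_def lv_def)
    show "S - Z \<subseteq> A" "B0 \<subseteq> C" by (auto simp: A_def C_def B0_def)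
    show "u \<in> S - Z \<and> v \<in> S - Z" if uv: "(u, v) \<in> E" "u \<in> A" "v \<in> A" for u v
      using inA[OF uv] inA[OF symD[OF assms(9) uv(1)] uv(3,2)] by simp
    show "u \<in> B0 \<and> v \<in> B0" if uv: "(u, v) \<in> E" "u \<in> C" "v \<in> C" for u v
    proof -
      have uvZ: "u \<in> Z" "v \<in> Z" using inC[OF uv] inC[OF symD[OF assms(9) uv(1)] uv(3,2)] by simp_all
      then have "\<not> card Z \<le> 1" using noloop[OF uv(1)] by blast
      then show ?thesis using uvZ by (simp add: B0_def)
    qed
    have fin: "finite A" "finite C" using VAC assms(6) by auto
    have "card A + card C = card V" using VAC AC fin by (simp add: card_Un_disjoint)
    then show "card A + card C + (k - 1 - 2) \<le> card W" using assms(15) by (simp add: numeral_3_eq_3)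
    have "t \<le> card A" using Z(2) card_mono[OF fin(1), of "lv Z"] by (auto simp: A_def)
    then show "S - Z = {} \<or> (card (S - Z) - 1) * (k - 1 - 1) < card A"
      using small[of "S - Z"] by auto
    show "B0 = {} \<or> (card B0 - 1) * (k - 1 - 1) < card C"
    proof (cases "card Z \<le> 1")
      case False
      then have "t \<le> card C" using many card_mono[OF fin(2), of "lv (S - Z)"] by (auto simp: C_def)
      then show ?thesis using small[OF Z(1)] False by (auto simp: B0_def)
    qed (simp add: B0_def)
  qed simp_all
qed

section \<open>Embedding sparse connected graphs into path-free sets\<close>

context bfs_graph
begin

lemma finite_nontree: "finite nontree"
  using finite_E by (auto simp: nontree_def)

text \<open>Levels are coloured by parity. \<open>Y\<close> covers the ends of the defective edges,
  and \<open>small\<close> is the room that each class needs for an independent set of that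
  size.\<close>

lemma embeds_parity:
  assumes "finite W" "path_free R W (k - 1)" "3 \<le> k" "symp R" "irreflp R"
    and "card V + (k - 3) \<le> card W"
    and Y: "\<And>u v. (u, v) \<in> nontree \<Longrightarrow> d u = d v \<Longrightarrow> u \<in> Y"
    and small: "\<And>c. Y \<inter> {v \<in> V. even (d v) = c} = {} \<or>
      (card (Y \<inter> {v \<in> V. even (d v) = c}) - 1) * (k - 2) < card {v \<in> V. even (d v) = c}"
  shows "embeds V E R W"
proof -
  let ?A = "\<lambda>c. {v \<in> V. even (d v) = c}"
  have AC: "V = ?A True \<union> ?A False" "?A True \<inter> ?A False = {}" by auto
  have fin: "finite (?A c)" for c using finite_V by simp
  have "card (?A True) + card (?A False) = card V"
    using card_Un_disjoint[OF fin fin AC(2)] AC(1) by simp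
  then have sz: "card (?A True) + card (?A False) + (k - 1 - 2) \<le> card W"
    using assms(6) by (simp add: numeral_3_eq_3)
  have k2: "k - 1 - 1 = k - 2" "2 \<le> k - 1" using assms(3) by auto
  have bad: "u \<in> Y \<and> v \<in> Y" if "(u, v) \<in> E" "even (d u) = even (d v)" for u v
    using Y same_parity[OF that] sym_nontree by metis
  show ?thesis
    by (rule embeds_almost_bipartite[OF assms(1,2) k2(2) assms(4,5) finite_V E_sub AC _ _ _ _
          order_refl order_refl sz, of "Y \<inter> ?A True" "Y \<inter> ?A False"])
      (use bad small[of True] small[of False] k2(1) in auto)
qed

text \<open>Swapping the colours on the subtree of \<open>x\<close> separates \<open>x\<close> from
  \<open>y\<close> and spoils only the edge from \<open>x\<close> to its parent. That edge lies in
  the class \<open>A\<close>, which contains the set counted in \<open>big\<close> and so has room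
  for one blue edge.\<close>

lemma embeds_flip:
  assumes "finite W" "path_free R W (k - 1)" "3 \<le> k" "symp R" "irreflp R"
    and "card V + (k - 3) \<le> card W"
    and xy: "nontree = {(x, y), (y, x)}" "x \<noteq> y" "d x = d y"
    and big: "k - 1 \<le> card ({v \<in> V. even (d v) \<noteq> even (d x)} - desc x)"
  shows "embeds V E R W"
proof -
  have "(x, y) \<in> E" using xy(1) by (auto simp: nontree_def)
  then have inV: "x \<in> V" "y \<in> V" using in_V by auto
  have "d x > 0"
  proof (rule ccontr)
    assume "\<not> d x > 0"
    then show False using d_zero[OF inV(1)] d_zero[OF inV(2)] xy(2,3) by simp
  qed
  then have "x \<noteq> r" using d_r by auto
  define col where "col v \<longleftrightarrow> ((even (d v) \<longleftrightarrow> even (d x)) \<longleftrightarrow> v \<notin> desc x)" for v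
  define A where "A = {v \<in> V. \<not> col v}"
  define C where "C = {v \<in> V. col v}"
  have AC: "V = A \<union> C" "A \<inter> C = {}" by (auto simp: A_def C_def)
  have fin: "finite A" "finite C" using finite_V by (auto simp: A_def C_def)
  have "card A + card C = card V" using AC fin by (simp add: card_Un_disjoint)
  then have sz: "card A + card C + (k - 1 - 2) \<le> card W"
    using assms(6) by (simp add: numeral_3_eq_3)
  have px: "par x \<in> V" "d x = Suc (d (par x))" "par x \<notin> desc x"
    using par_arc[OF inV(1) \<open>x \<noteq> r\<close>] in_V d_par[OF inV(1) \<open>x \<noteq> r\<close>]
      par_notin_desc[OF inV(1) \<open>x \<noteq> r\<close>] by auto
  have xA: "{x, par x} \<subseteq> A" using px inV desc_self by (auto simp: A_def col_def)
  have "y \<notin> desc x" using desc_disjoint[OF inV(2) _ desc_self xy(3) \<open>d x > 0\<close>] xy(2) by auto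
  then have "col y" using xy(3) by (simp add: col_def)
  have "\<not> col x" using xA by (auto simp: A_def)
  have tree: "col v \<noteq> col (par v)" if "v \<in> V" "v \<noteq> r" "v \<noteq> x" for v
    using d_par[OF that(1,2)] desc_par[OF that(3)] by (auto simp: col_def)
  have mono: "{u, v} = {x, par x}" if "(u, v) \<in> E" "col u = col v" for u v
    using that(1)
  proof (cases rule: arc_cases)
    case 1
    then show ?thesis using xy(1) \<open>col y\<close> \<open>\<not> col x\<close> that(2) by auto
  next
    case 2
    then show ?thesis using tree[of u] in_V[OF that(1)] that(2) by auto
  next
    case 3
    then show ?thesis using tree[of v] in_V[OF that(1)] that(2) by auto
  qed
  have "{v \<in> V. even (d v) \<noteq> even (d x)} - desc x \<subseteq> A" by (auto simp: A_def col_def)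
  then have "k - 1 \<le> card A" using big card_mono[OF fin(1)] le_trans by blast
  moreover have "card {x, par x} \<le> 2" by (simp add: card_insert_if)
  then have "(card {x, par x} - 1) * (k - 1 - 1) \<le> 1 * (k - 1 - 1)" by (intro mult_le_mono1) simp
  ultimately have "(card {x, par x} - 1) * (k - 1 - 1) < card A" using assms(3) by linarith
  then have szA: "{x, par x} = {} \<or> (card {x, par x} - 1) * (k - 1 - 1) < card A" ..
  have k2: "2 \<le> k - 1" using assms(3) by simp
  have monoA: "u \<in> {x, par x} \<and> v \<in> {x, par x}" if "(u, v) \<in> E" "u \<in> A" "v \<in> A" for u v
    using mono[OF that(1)] that(2,3) by (auto simp: A_def)
  have monoC: "u \<in> {} \<and> v \<in> {}" if "(u, v) \<in> E" "u \<in> C" "v \<in> C" for u v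
  proof -
    have "{u, v} = {x, par x}" using mono[OF that(1)] that(2,3) by (auto simp: C_def)
    then have "u \<in> {x, par x}" by blast
    then have "u \<in> A" using xA by blast
    then show ?thesis using that(2) AC(2) by auto
  qed
  show ?thesis
    by (rule embeds_almost_bipartite[OF assms(1,2) k2 assms(4,5) finite_V E_sub AC xA _ monoA monoC
          order_refl order_refl sz szA]) auto
qed

text \<open>If the nontree edge lies inside a level whose parity class is too small for a blue edge,
  the opposite class has at least \<open>2 * k + 3\<close> vertices. The subtrees of
  \<open>x\<close> and \<open>y\<close> are disjoint, so at least \<open>k - 1\<close> of these
  avoid one of the subtrees, and that subtree is flipped.\<close>

lemma embeds_unicyclic:
  assumes "finite W" "path_free R W (k - 1)" "3 \<le> k" "symp R" "irreflp R"
    and "card V + (k - 3) \<le> card W" "3 * k + 1 \<le> card V" "card nontree = 2"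
  shows "embeds V E R W"
proof -
  have "nontree \<noteq> {}" using assms(8) by auto
  then obtain x y where "(x, y) \<in> nontree" by auto
  then have "(y, x) \<in> nontree" by (rule sym_nontree)
  have E: "(x, y) \<in> E" using \<open>(x, y) \<in> nontree\<close> by (auto simp: nontree_def)
  then have "x \<noteq> y" using E_irrefl by auto
  then have "card {(x, y), (y, x)} = 2" by simp
  then have xy: "nontree = {(x, y), (y, x)}"
    using card_subset_eq[of nontree "{(x, y), (y, x)}"] finite_nontree assms(8)
      \<open>(x, y) \<in> nontree\<close> \<open>(y, x) \<in> nontree\<close> by auto
  then have yx: "nontree = {(y, x), (x, y)}" by auto
  have inV: "x \<in> V" "y \<in> V" using E in_V by auto
  show ?thesis
  proof (cases "d x = d y")
    case False
    then show ?thesis using xy by (intro embeds_parity[OF assms(1-6), of "{}"]) auto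
  next
    case dxy: True
    have "d x > 0"
    proof (rule ccontr)
      assume "\<not> d x > 0"
      then show False using d_zero[OF inV(1)] d_zero[OF inV(2)] dxy \<open>x \<noteq> y\<close> by simp
    qed
    let ?same = "{v \<in> V. even (d v) = even (d x)}" and ?opp = "{v \<in> V. even (d v) \<noteq> even (d x)}"
    show ?thesis
    proof (cases "k - 1 \<le> card ?same")
      case True
      have "(card ({x, y} \<inter> {v \<in> V. even (d v) = c}) - 1) * (k - 2) < card {v \<in> V. even (d v) = c}"
        if "{x, y} \<inter> {v \<in> V. even (d v) = c} \<noteq> {}" for c
      proof -
        have c: "c = even (d x)" using that dxy by auto
        have "card ({x, y} \<inter> {v \<in> V. even (d v) = c}) \<le> card {x, y}" by (intro card_mono) auto
        also have "\<dots> = 2" using \<open>x \<noteq> y\<close> by simp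
        finally have "(card ({x, y} \<inter> {v \<in> V. even (d v) = c}) - 1) * (k - 2) \<le> 1 * (k - 2)"
          by (intro mult_le_mono1) simp
        moreover have "1 * (k - 2) < card {v \<in> V. even (d v) = c}"
          using True assms(3) unfolding c by linarith
        ultimately show ?thesis by (rule le_less_trans)
      qed
      then have "{x, y} \<inter> {v \<in> V. even (d v) = c} = {} \<or>
          (card ({x, y} \<inter> {v \<in> V. even (d v) = c}) - 1) * (k - 2) < card {v \<in> V. even (d v) = c}"
        for c by blast
      moreover have "u \<in> {x, y}" if "(u, v) \<in> nontree" for u v using that xy by auto
      ultimately show ?thesis by (intro embeds_parity[OF assms(1-6), of "{x, y}"])
    next
      case False
      have fin: "finite ?opp" "finite ?same" using finite_V by auto
      have "V = ?same \<union> ?opp" "?same \<inter> ?opp = {}" by auto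
      then have "card V = card ?same + card ?opp" using card_Un_disjoint[OF fin(2,1)] by metis
      then have "2 * k + 3 \<le> card ?opp" using False assms(3,7) by linarith
      have "?opp \<subseteq> (?opp - desc x) \<union> (?opp - desc y)"
        using desc_disjoint[of _ x y] dxy \<open>d x > 0\<close> \<open>x \<noteq> y\<close> by blast
      then have "card ?opp \<le> card ((?opp - desc x) \<union> (?opp - desc y))"
        using fin by (intro card_mono) auto
      also have "\<dots> \<le> card (?opp - desc x) + card (?opp - desc y)" by (rule card_Un_le)
      finally have "k - 1 \<le> card (?opp - desc x) \<or> k - 1 \<le> card (?opp - desc y)"
        using \<open>2 * k + 3 \<le> card ?opp\<close> by linarith
      then show ?thesis
      proof
        assume "k - 1 \<le> card (?opp - desc x)"
        then show ?thesis by (rule embeds_flip[OF assms(1-6) xy \<open>x \<noteq> y\<close> dxy])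
      next
        assume "k - 1 \<le> card (?opp - desc y)"
        then show ?thesis
          using embeds_flip[OF assms(1-6) yx _ dxy[symmetric]] \<open>x \<noteq> y\<close> dxy by simp
      qed
    qed
  qed
qed

text \<open>\<open>S\<close> collects the small parity class, its parents, the ends of nontree edges
  and the root. Any other vertex has its parent in the small class and no child, since a child would
  lie in the small class and put the vertex among the parents. So it is a leaf attached to
  \<open>S\<close>.\<close>

lemma embeds_small_side:
  assumes "finite W" "path_free R W (k - 1)" "3 \<le> k" "symp R" "irreflp R"
    and "card V + (k - 3) \<le> card W" "card nontree = 2 * t" "2 \<le> t" "27 * k\<^sup>2 * (t - 1) \<le> card V"
    and few: "card {v \<in> V. even (d v) = c} < 2 * t * (k - 2)"
  shows "embeds V E R W"
proof -
  let ?B = "{v \<in> V. even (d v) = c}"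
  define S where "S = ?B \<union> par ` ?B \<union> fst ` nontree \<union> {r}"
  have par_V: "par v \<in> V" if "v \<in> V" for v
    using that par_arc[of v] par_r in_V by (cases "v = r") auto
  have SV: "S \<subseteq> V" using par_V r_in in_V by (auto simp: S_def nontree_def)
  have finB: "finite ?B" using finite_V by simp
  have "card (fst ` nontree) \<le> 2 * t" using card_image_le[OF finite_nontree, of fst] assms(7) by simp
  moreover have "card (par ` ?B) \<le> card ?B" by (rule card_image_le[OF finB])
  moreover have "card S \<le> card ?B + card (par ` ?B) + card (fst ` nontree) + card {r}"
    unfolding S_def by (meson add_right_mono card_Un_le le_trans)
  moreover have "card {r} = 1" by simp
  ultimately have sS: "card S + 1 \<le> 4 * t * (k - 2) + 2 * t" using few by linarith
  obtain j where j: "k = j + 3" using assms(3) by (metis le_add_diff_inverse2)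
  define l where "l = t - 1"
  have l: "t = l + 1" "1 \<le> l" using assms(8) by (auto simp: l_def)
  \<comment> \<open>From \<open>2 <= t\<close> follows \<open>t <= 2 * l\<close>. This leads to
    \<open>card S <= 8 * k * l\<close>, and multiplying by \<open>3 * k\<close> stays within the
    constant 27.\<close>
  have "4 * t * (k - 2) + 2 * t \<le> l * (8 * (k - 2) + 4)"
  proof -
    have "t * (4 * (k - 2) + 2) \<le> (2 * l) * (4 * (k - 2) + 2)" using l by (intro mult_le_mono1) simp
    then show ?thesis by (simp add: algebra_simps)
  qed
  then have "card S \<le> l * (8 * k)" using sS j by (simp add: algebra_simps)
  then have "card S * (3 * k - 5) \<le> (l * (8 * k)) * (3 * k)" by (intro mult_le_mono) auto
  also have "\<dots> \<le> 27 * k\<^sup>2 * (t - 1)" using l by (simp add: power2_eq_square algebra_simps)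
  finally have szS: "card S * (3 * k - 5) \<le> card V" using assms(9) by linarith
  have leaf: "v = par u" if "(u, v) \<in> E" "u \<in> V - S" for u v
    using that(1)
  proof (cases rule: arc_cases)
    case 1
    then have "u \<in> fst ` nontree" by (intro image_eqI[of _ _ "(u, v)"]) simp
    then show ?thesis using that(2) by (simp add: S_def)
  next
    case 3
    then have "v \<in> V" "d v = Suc (d u)" using in_V[OF that(1)] d_par by auto
    moreover have "even (d u) \<noteq> c" using that(2) by (auto simp: S_def)
    ultimately have "v \<in> ?B" by auto
    then show ?thesis using 3 that(2) by (auto simp: S_def)
  qed
  have pS: "par u \<in> S" if "u \<in> V - S" for u
  proof -
    have "u \<noteq> r" "u \<in> V" "even (d u) \<noteq> c" using that by (auto simp: S_def)
    then have "par u \<in> ?B" using d_par[of u] par_V[of u] by auto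
    then show ?thesis by (auto simp: S_def)
  qed
  have "S \<noteq> {}" by (auto simp: S_def)
  show ?thesis
    by (rule embeds_hubs_with_leaves[OF assms(1-5) finite_V E_sub E_irrefl E_sym SV \<open>S \<noteq> {}\<close>
          leaf pS szS assms(6)])
qed

text \<open>If no parity class is small, each has at least \<open>2 * t * (k - 2)\<close> vertices,
  enough for the at most \<open>2 * t\<close> ends of nontree edges.\<close>

lemma embeds_large_excess:
  assumes "finite W" "path_free R W (k - 1)" "3 \<le> k" "symp R" "irreflp R"
    and "card V + (k - 3) \<le> card W" "card nontree = 2 * t" "2 \<le> t" "27 * k\<^sup>2 * (t - 1) \<le> card V"
  shows "embeds V E R W"
proof (cases "\<exists>c. card {v \<in> V. even (d v) = c} < 2 * t * (k - 2)")
  case True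
  then show ?thesis using embeds_small_side[OF assms] by blast
next
  case False
  let ?Y = "fst ` nontree"
  have cY: "card ?Y \<le> 2 * t" using card_image_le[OF finite_nontree, of fst] assms(7) by simp
  have "(card (?Y \<inter> {v \<in> V. even (d v) = c}) - 1) * (k - 2) < card {v \<in> V. even (d v) = c}" for c
  proof -
    have "card (?Y \<inter> {v \<in> V. even (d v) = c}) \<le> 2 * t"
      using cY card_mono[of ?Y "?Y \<inter> {v \<in> V. even (d v) = c}"] finite_nontree by fastforce
    then have "card (?Y \<inter> {v \<in> V. even (d v) = c}) - 1 < 2 * t" using assms(8) by simp
    then have "(card (?Y \<inter> {v \<in> V. even (d v) = c}) - 1) * (k - 2) < 2 * t * (k - 2)"
      using assms(3) by simp
    then show ?thesis using False by (meson le_less_trans linorder_not_less less_le_trans)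
  qed
  moreover have "u \<in> ?Y" if "(u, v) \<in> nontree" for u v using that by force
  ultimately show ?thesis by (intro embeds_parity[OF assms(1-6), of ?Y]) blast+
qed

end

lemma (in conn_graph) embeds_if_path_free:
  assumes "finite W" "path_free R W (k - 1)" "3 \<le> k" "symp R" "irreflp R"
    and "card V + (k - 3) \<le> card W" "3 * k + 1 \<le> card V"
    and "card E = 2 * (card V - 1) + 2 * t" "2 \<le> t \<Longrightarrow> 27 * k\<^sup>2 * (t - 1) \<le> card V"
  shows "embeds V E R W"
proof -
  obtain r d par where "bfs_graph V E r d par" using bfs_graph_exists by blast
  then interpret bfs_graph V E r d par .
  have ct: "card nontree = 2 * t" using card_nontree assms(8) by simp
  consider "t = 0" | "t = 1" | "2 \<le> t" by linarith
  then show ?thesis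
  proof cases
    case 1
    then have "nontree = {}" using ct finite_nontree by simp
    then show ?thesis by (intro embeds_parity[OF assms(1-6), of "{}"]) auto
  next
    case 2
    then show ?thesis using embeds_unicyclic[OF assms(1-7)] ct by simp
  next
    case 3
    then show ?thesis using embeds_large_excess[OF assms(1-6) ct 3 assms(9)] by simp
  qed
qed

section \<open>Suspended paths\<close>

context conn_graph
begin

abbreviation deg :: "'a \<Rightarrow> nat" where "deg v \<equiv> card (E `` {v})"

lemma finite_nbhd: "finite (E `` {v})"
  by (rule finite_subset[OF _ finite_V]) (use E_sub in auto)

lemma nbhd_eq:
  assumes "(v, a) \<in> E" "(v, b) \<in> E" "a \<noteq> b" "deg v = 2"
  shows "E `` {v} = {a, b}"
  using card_subset_eq[OF finite_nbhd, of "{a, b}" v] assms by simp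

lemma deg_pos:
  assumes "v \<in> V" "card V \<ge> 2"
  shows "deg v \<ge> 1"
proof -
  have "V \<noteq> {v}" using assms(2) by auto
  then obtain u where "(v, u) \<in> E" using cut[of "{v}"] assms(1) by auto
  then have "E `` {v} \<noteq> {}" by auto
  then show ?thesis using finite_nbhd by (simp add: Suc_le_eq card_gt_0_iff)
qed

text \<open>A cut of the smaller graph is extended by putting \<open>v\<close> on the side of its
  neighbour, so that the crossing arc avoids \<open>v\<close>.\<close>

lemma remove_leaf:
  assumes "v \<in> V" "E `` {v} = {u}"
  shows "conn_graph (V - {v}) (E \<inter> (V - {v}) \<times> (V - {v}))" (is "conn_graph ?V ?E")
    and "card (E \<inter> (V - {v}) \<times> (V - {v})) = card E - 2"
proof -
  have "(v, u) \<in> E" using assms(2) by auto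
  then have uv: "(v, u) \<in> E" "(u, v) \<in> E" "u \<noteq> v" "u \<in> V"
    using E_symD E_irrefl in_V by blast+
  have only: "w = u" if "(w, v) \<in> E" for w using E_symD[OF that] assms(2) by auto
  show "conn_graph ?V ?E"
  proof
    show "finite ?V" using finite_V by simp
    show "?V \<noteq> {}" using uv by auto
    show "?E \<subseteq> ?V \<times> ?V" by auto
    show "sym ?E" using E_sym by (auto simp: sym_def)
    show "(w, w) \<notin> ?E" for w using E_irrefl by auto
    fix S assume S: "S \<subseteq> ?V" "S \<noteq> {}" "S \<noteq> ?V"
    define S' where "S' = (if u \<in> S then insert v S else S)"
    have "S' \<subseteq> V" "S' \<noteq> {}" "S' \<noteq> V" using S assms(1) uv by (auto simp: S'_def split: if_splits)
    then obtain a b where ab: "a \<in> S'" "b \<in> V - S'" "(a, b) \<in> E" using cut by blast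
    have "a \<noteq> v"
    proof
      assume "a = v"
      then have "u \<in> S" using ab(1) S(1) by (auto simp: S'_def split: if_splits)
      moreover have "b = u" using ab(3) \<open>a = v\<close> assms(2) by auto
      ultimately show False using ab(2) by (auto simp: S'_def)
    qed
    moreover have "b \<noteq> v"
    proof
      assume "b = v"
      then have "a = u" using only ab(3) by simp
      then show False using ab \<open>b = v\<close> by (auto simp: S'_def split: if_splits)
    qed
    ultimately have "a \<in> S" "b \<in> ?V - S" "(a, b) \<in> ?E"
      using ab S(1) in_V[OF ab(3)] by (auto simp: S'_def split: if_splits)
    then show "\<exists>a\<in>S. \<exists>b\<in>?V - S. (a, b) \<in> ?E" by blast
  qed
  have "?E = E - {(v, u), (u, v)}" using only assms(2) in_V uv(3) by auto
  then show "card ?E = card E - 2" using uv finite_E by (simp add: card_Diff_subset)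
qed

text \<open>\<open>y\<close> is an inner vertex of a suspended path, and \<open>x\<close>, \<open>z\<close> are its neighbours.\<close>

lemma contract:
  assumes "E `` {y} = {x, z}" "x \<noteq> z" "(x, z) \<notin> E" "y \<in> V"
  shows "conn_graph (V - {y}) (E \<inter> (V - {y}) \<times> (V - {y}) \<union> {(x, z), (z, x)})"
      (is "conn_graph ?V ?E")
    and "card (E \<inter> (V - {y}) \<times> (V - {y}) \<union> {(x, z), (z, x)}) = card E - 2"
    and "card E \<ge> 4"
proof -
  have "(y, x) \<in> E" "(y, z) \<in> E" using assms(1) by auto
  then have xyz: "(y, x) \<in> E" "(x, y) \<in> E" "(y, z) \<in> E" "(z, y) \<in> E" "x \<noteq> y" "z \<noteq> y" "x \<in> V" "z \<in> V"
    using E_symD E_irrefl in_V by blast+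
  have only: "w = x \<or> w = z" if "(w, y) \<in> E" for w using E_symD[OF that] assms(1) by auto
  show "conn_graph ?V ?E"
  proof
    show "finite ?V" using finite_V by simp
    show "?V \<noteq> {}" using xyz by auto
    show "?E \<subseteq> ?V \<times> ?V" using xyz by auto
    show "sym ?E" using E_sym by (auto simp: sym_def)
    show "(w, w) \<notin> ?E" for w using E_irrefl assms(2) by auto
    fix S assume S: "S \<subseteq> ?V" "S \<noteq> {}" "S \<noteq> ?V"
    show "\<exists>a\<in>S. \<exists>b\<in>?V - S. (a, b) \<in> ?E"
    \<comment> \<open>A cut separating \<open>x\<close> from \<open>z\<close> is crossed by the new
      edge; otherwise \<open>y\<close> joins the common side of \<open>x\<close> and
      \<open>z\<close>, and a crossing arc of the old graph avoids \<open>y\<close>.\<close>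
    proof (cases "x \<in> S \<longleftrightarrow> z \<in> S")
      case False
      then show ?thesis using xyz by auto
    next
      case True
      define S' where "S' = (if x \<in> S then insert y S else S)"
      have "S' \<subseteq> V" "S' \<noteq> {}" "S' \<noteq> V" using S assms(4) xyz by (auto simp: S'_def split: if_splits)
      then obtain a b where ab: "a \<in> S'" "b \<in> V - S'" "(a, b) \<in> E" using cut by blast
      have "a \<noteq> y"
      proof
        assume "a = y"
        then have "x \<in> S" using ab(1) S(1) by (auto simp: S'_def split: if_splits)
        moreover have "b = x \<or> b = z" using ab(3) \<open>a = y\<close> assms(1) by auto
        ultimately show False using ab(2) True by (auto simp: S'_def)
      qed
      moreover have "b \<noteq> y"
      proof
        assume "b = y"
        then have "a = x \<or> a = z" using only ab(3) by simp
        then show False using ab \<open>b = y\<close> True xyz by (auto simp: S'_def split: if_splits)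
      qed
      ultimately have "a \<in> S" "b \<in> ?V - S" "(a, b) \<in> ?E"
        using ab S(1) in_V[OF ab(3)] by (auto simp: S'_def split: if_splits)
      then show ?thesis by blast
    qed
  qed
  \<comment> \<open>Four arcs at \<open>y\<close> disappear and two new ones are added, so one
    vertex and one edge are lost and the excess is unchanged.\<close>
  let ?D = "{(y, x), (x, y), (y, z), (z, y)}"
  have "card ?D = 4" using xyz assms(2) by simp
  moreover have "?D \<subseteq> E" using xyz by auto
  ultimately show "card E \<ge> 4" using card_mono[OF finite_E, of ?D] by simp
  have "E \<inter> ?V \<times> ?V = E - ?D" using only assms(1) in_V by auto
  then have "card (E \<inter> ?V \<times> ?V) = card E - 4"
    using \<open>?D \<subseteq> E\<close> \<open>card ?D = 4\<close> by (simp only: card_Diff_subset finite.intros)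
  moreover have "(z, x) \<notin> E" using assms(3) E_symD by blast
  ultimately show "card ?E = card E - 2"
    using assms(2,3) finite_E \<open>card E \<ge> 4\<close> by (subst card_Un_disjoint) auto
qed

text \<open>If the first repeated vertex were \<open>q i\<close> with \<open>i > 0\<close>, the walk
  would return to it from one of its only two neighbours \<open>q (i - 1)\<close> and
  \<open>q (i + 1)\<close>, which contradicts either the choice of the first repetition or the
  absence of backtracking.\<close>

lemma walk_repeats_at_start:
  assumes walk: "\<And>i. (q i, q (Suc i)) \<in> E" "\<And>i. q (Suc (Suc i)) \<noteq> q i"
    and deg2: "\<And>i. 1 \<le> i \<Longrightarrow> i \<le> m \<Longrightarrow> deg (q i) = 2"
    and "\<not> inj_on q {..Suc m}"
  obtains j where "3 \<le> j" "j \<le> Suc m" "inj_on q {..<j}" "q j = q 0"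
proof -
  define P where "P j \<longleftrightarrow> (\<exists>i<j. q i = q j)" for j
  have "\<exists>j\<le>Suc m. P j"
    using assms(4) unfolding inj_on_def P_def by (metis atMost_iff linorder_neqE_nat)
  then obtain j0 where "P j0" "j0 \<le> Suc m" by auto
  define j where "j = (LEAST j. P j)"
  have "P j" unfolding j_def using \<open>P j0\<close> by (rule LeastI)
  have "j \<le> Suc m" unfolding j_def using Least_le[of P j0] \<open>P j0\<close> \<open>j0 \<le> Suc m\<close> by simp
  have inj: "inj_on q {..<j}"
  proof (rule inj_onI)
    fix a b assume ab: "a \<in> {..<j}" "b \<in> {..<j}" "q a = q b"
    have "\<not> P a" "\<not> P b"
      using ab(1,2) not_less_Least[of a P] not_less_Least[of b P] by (simp_all add: j_def)
    then have "\<not> a < b" "\<not> b < a" using ab(3) by (auto simp: P_def)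
    then show "a = b" by simp
  qed
  obtain i where i: "i < j" "q i = q j" using \<open>P j\<close> by (auto simp: P_def)
  have nj1: "q (Suc a) \<noteq> q a" for a using walk(1)[of a] E_irrefl by metis
  have "i = 0"
  proof (rule ccontr)
    assume "i \<noteq> 0"
    then obtain i' where i': "i = Suc i'" by (cases i) auto
    obtain j' where j': "j = Suc j'" using i by (cases j) auto
    have "deg (q i) = 2" using i(1) i' \<open>j \<le> Suc m\<close> by (intro deg2) auto
    moreover have "(q i, q i') \<in> E" "(q i, q (Suc i)) \<in> E" "q i' \<noteq> q (Suc i)"
      using walk(1)[of i'] walk(1)[of i] walk(2)[of i'] E_symD i' by auto
    ultimately have "E `` {q i} = {q i', q (Suc i)}" using nbhd_eq by blast
    moreover have "(q i, q j') \<in> E" using walk(1)[of j'] E_symD i(2) j' by auto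
    ultimately consider "q j' = q i'" | "q j' = q (Suc i)" by auto
    then show False
    proof cases
      case 1
      then have "j' = i'" using inj_onD[OF inj, of j' i'] i(1) i' j' by auto
      then show False using i(1) i' j' by simp
    next
      case 2
      have "Suc i \<noteq> j" using i(2) nj1[of i] by auto
      then have "Suc i < j" using i(1) by simp
      then have "j' = Suc i" using inj_onD[OF inj 2] j' by auto
      then show False using walk(2)[of i] i(2) j' by auto
    qed
  qed
  moreover have "j \<noteq> 1" using i(2) nj1[of 0] \<open>i = 0\<close> by auto
  moreover have "j \<noteq> 2" using i(2) walk(2)[of 0] \<open>i = 0\<close> by (auto simp: numeral_2_eq_2)
  ultimately show thesis using that[of j] i \<open>j \<le> Suc m\<close> inj by auto
qed

text \<open>Both neighbours of every vertex on the closed walk lie on it, so no arc leaves it and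
  connectedness makes it the whole graph.\<close>

lemma closed_walk_spans:
  assumes walk: "\<And>i. (q i, q (Suc i)) \<in> E" "\<And>i. q (Suc (Suc i)) \<noteq> q i"
    and "3 \<le> j" "inj_on q {..<j}" "q j = q 0" and deg2: "\<And>i. i < j \<Longrightarrow> deg (q i) = 2"
  shows "V = q ` {..<j}"
    and "\<And>u v. (u, v) \<in> E \<Longrightarrow> \<exists>i<j. (u = q i \<and> v = q (Suc i)) \<or> (v = q i \<and> u = q (Suc i))"
proof -
  have nb: "\<exists>l<j. (q i = q l \<and> v = q (Suc l)) \<or> (v = q l \<and> q i = q (Suc l))"
    if "i < j" "(q i, v) \<in> E" for i v
  proof -
    define p where "p = (if i = 0 then j - 1 else i - 1)"
    have p: "p < j" "q (Suc p) = q i" using assms(3,5) that(1) by (auto simp: p_def)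
    have "q p \<noteq> q (Suc i)"
    proof (cases "i = 0")
      case True
      have "q (j - 1) \<noteq> q 1" using assms(3) inj_onD[OF assms(4), of "j - 1" 1] by auto
      then show ?thesis using True by (simp add: p_def)
    next
      case False
      then obtain i' where "i = Suc i'" by (cases i) auto
      then show ?thesis using walk(2)[of i'] by (simp add: p_def)
    qed
    moreover have "(q i, q p) \<in> E" using walk(1)[of p] p(2) E_symD by auto
    ultimately have "E `` {q i} = {q p, q (Suc i)}" using nbhd_eq walk(1) deg2[OF that(1)] by blast
    then have "v = q p \<or> v = q (Suc i)" using that(2) by auto
    then show ?thesis using p that(1) by metis
  qed
  show V: "V = q ` {..<j}"
  proof (rule ccontr)
    assume "V \<noteq> q ` {..<j}"
    moreover have "q ` {..<j} \<subseteq> V" using walk(1) in_V by blast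
    ultimately obtain u v where uv: "u \<in> q ` {..<j}" "v \<in> V - q ` {..<j}" "(u, v) \<in> E"
      using cut[of "q ` {..<j}"] assms(3) by fastforce
    then obtain i where i: "u = q i" "i < j" by auto
    have closed: "q (Suc l) \<in> q ` {..<j}" if "l < j" for l
    proof (cases "Suc l = j")
      case True
      then show ?thesis using assms(3,5) by force
    qed (use that in auto)
    then obtain l where "l < j" "v = q (Suc l) \<or> v = q l" using nb[OF i(2), of v] uv(3) unfolding i(1) by metis
    then show False using closed[of l] uv(2) by auto
  qed
  show "\<exists>i<j. (u = q i \<and> v = q (Suc i)) \<or> (v = q i \<and> u = q (Suc i))" if "(u, v) \<in> E" for u v
    using nb that in_V[OF that] V by auto
qed

end

section \<open>Non-backtracking walks and branch vertices\<close>

locale min_deg2_graph = conn_graph +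
  assumes deg_ge2: "v \<in> V \<Longrightarrow> 2 \<le> deg v"
begin

text \<open>Defined on arcs, because the continuation depends on the vertex one comes from. The
  choice is arbitrary at branch vertices but forced, hence reversible, at vertices of degree
  2.\<close>

definition step :: "'a \<times> 'a \<Rightarrow> 'a \<times> 'a" where
  "step e = (snd e, SOME w. (snd e, w) \<in> E \<and> w \<noteq> fst e)"

lemma step:
  assumes "e \<in> E"
  shows "step e \<in> E" "snd (step e) \<noteq> fst e" "fst (step e) = snd e"
proof -
  obtain u v where e: "e = (u, v)" by (cases e)
  have "\<exists>w. (v, w) \<in> E \<and> w \<noteq> u"
  proof (rule ccontr)
    assume "\<not> ?thesis"
    then have "E `` {v} \<subseteq> {u}" by auto
    then have "deg v \<le> 1" using card_mono[of "{u}" "E `` {v}"] by simp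
    then show False using deg_ge2[of v] in_V assms e by fastforce
  qed
  from someI_ex[OF this] show "step e \<in> E" "snd (step e) \<noteq> fst e" by (auto simp: step_def e)
  show "fst (step e) = snd e" by (simp add: step_def)
qed

lemma step_funpow_in: "e \<in> E \<Longrightarrow> (step ^^ i) e \<in> E"
  by (induction i) (auto intro: step)

definition walk :: "'a \<times> 'a \<Rightarrow> nat \<Rightarrow> 'a" where "walk e i = fst ((step ^^ i) e)"

lemma snd_funpow: "e \<in> E \<Longrightarrow> snd ((step ^^ i) e) = walk e (Suc i)"
  by (simp add: walk_def step(3)[OF step_funpow_in])

lemma walk_arc: "e \<in> E \<Longrightarrow> (walk e i, walk e (Suc i)) \<in> E"
  using step_funpow_in[of e i] snd_funpow[of e i] by (metis prod.collapse walk_def)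

lemma walk_nonbacktracking: "e \<in> E \<Longrightarrow> walk e (Suc (Suc i)) \<noteq> walk e i"
  using step(2)[OF step_funpow_in[of e i]] snd_funpow[of e "Suc i"] by (simp add: walk_def)

text \<open>Both arcs enter the same vertex of degree 2 and leave it towards the same
  \<open>w\<close>, so both come from its other neighbour.\<close>

lemma step_inj:
  assumes "e \<in> E" "e' \<in> E" "step e = step e'" "deg (snd e) = 2"
  shows "e = e'"
proof -
  obtain u v where e: "e = (u, v)" by (cases e)
  obtain u' where e': "e' = (u', v)" using step(3)[OF assms(1)] step(3)[OF assms(2)] assms(3) e
    by (cases e') auto
  define w where "w = snd (step e)"
  have w: "(v, w) \<in> E" "w \<noteq> u" "w \<noteq> u'"
    using step[OF assms(1)] step[OF assms(2)] assms(3) e e' by (metis fst_conv prod.collapse snd_conv w_def)+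
  have "(v, u) \<in> E" "(v, u') \<in> E" using assms(1,2) e e' E_symD by auto
  moreover have "E `` {v} = {u, w}" using nbhd_eq[of v u w] w \<open>(v, u) \<in> E\<close> assms(4) e by auto
  ultimately show ?thesis using w e e' by auto
qed

lemma step_funpow_inj:
  assumes "e \<in> E" "e' \<in> E" "(step ^^ i) e = (step ^^ i) e'"
    and "\<And>l. l < i \<Longrightarrow> deg (walk e (Suc l)) = 2"
  shows "e = e'"
  using assms(3,4)
proof (induction i)
  case (Suc i)
  have "step ((step ^^ i) e) = step ((step ^^ i) e')" using Suc.prems(1) by simp
  moreover have "deg (snd ((step ^^ i) e)) = 2" using Suc.prems(2)[of i] snd_funpow[OF assms(1)] by simp
  ultimately have "(step ^^ i) e = (step ^^ i) e'"
    using step_inj step_funpow_in assms(1,2) by blast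
  then show ?case using Suc by simp
qed simp

text \<open>Following an arc forward until a vertex of degree at least 3 is reached determines the arc
  from its last arc and its length.\<close>

lemma card_arcs_le:
  assumes "\<And>e. e \<in> E \<Longrightarrow> \<exists>i. 1 \<le> i \<and> i \<le> L \<and> deg (walk e i) \<noteq> 2"
  shows "card E \<le> card {e \<in> E. deg (snd e) \<noteq> 2} * L"
proof -
  \<comment> \<open>The head of the arc after \<open>i\<close> steps is
    \<open>walk e (Suc i)\<close>, so \<open>len e\<close> counts the steps until an arc points into
    a branch vertex; it is below \<open>L\<close> although the walk index may reach
    \<open>L\<close>.\<close>
  define len where "len e = (LEAST i. deg (walk e (Suc i)) \<noteq> 2)" for e
  define F where "F e = ((step ^^ len e) e, len e)" for e
  have len: "deg (walk e (Suc (len e))) \<noteq> 2" "len e < L" "\<And>l. l < len e \<Longrightarrow> deg (walk e (Suc l)) = 2"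
    if "e \<in> E" for e
  proof -
    obtain i where i: "1 \<le> i" "i \<le> L" "deg (walk e i) \<noteq> 2" using assms[OF \<open>e \<in> E\<close>] by auto
    then obtain i' where i': "i = Suc i'" by (cases i) auto
    show "deg (walk e (Suc (len e))) \<noteq> 2"
      unfolding len_def by (rule LeastI[of _ i']) (use i i' in simp)
    have "len e \<le> i'" unfolding len_def by (rule Least_le) (use i i' in simp)
    then show "len e < L" using i i' by simp
    show "deg (walk e (Suc l)) = 2" if "l < len e" for l
      using not_less_Least that unfolding len_def by blast
  qed
  have "inj_on F E"
  proof (rule inj_onI)
    fix e e' assume e: "e \<in> E" "e' \<in> E" "F e = F e'"
    then have "len e' = len e" "(step ^^ len e) e = (step ^^ len e) e'" by (auto simp: F_def)
    then show "e = e'" using step_funpow_inj[OF e(1,2)] len(3)[OF e(1)] by blast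
  qed
  moreover have "F ` E \<subseteq> {e \<in> E. deg (snd e) \<noteq> 2} \<times> {..<L}"
  proof
    fix y assume "y \<in> F ` E"
    then obtain e where e: "e \<in> E" "y = F e" by auto
    have "deg (snd ((step ^^ len e) e)) \<noteq> 2" using len(1)[OF e(1)] snd_funpow[OF e(1)] by simp
    then show "y \<in> {e \<in> E. deg (snd e) \<noteq> 2} \<times> {..<L}"
      using e len(2) step_funpow_in by (simp add: F_def)
  qed
  ultimately have "card E \<le> card ({e \<in> E. deg (snd e) \<noteq> 2} \<times> {..<L})"
    using finite_E by (intro card_inj_on_le) auto
  then show ?thesis by (simp add: card_cartesian_product)
qed

text \<open>A degree \<open>g >= 3\<close> satisfies \<open>g <= 3 * (g - 2)\<close>, and the sum of
  all \<open>deg v - 2\<close> is \<open>card E - 2 * card V\<close>, that is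
  \<open>2 * (t - 1)\<close>.\<close>

lemma card_branch_arcs_le:
  assumes "card E + 2 = 2 * card V + 2 * t"
  shows "card {e \<in> E. deg (snd e) \<noteq> 2} \<le> 6 * (t - 1)"
proof -
  define br where "br = {v \<in> V. deg v \<noteq> 2}"
  have fin: "finite br" using finite_V by (simp add: br_def)
  have "prod.swap ` {e \<in> E. deg (snd e) \<noteq> 2} = Sigma br (\<lambda>v. E `` {v})"
  proof (intro set_eqI iffI)
    fix e assume "e \<in> prod.swap ` {e \<in> E. deg (snd e) \<noteq> 2}"
    then obtain u v where "(u, v) \<in> E" "deg v \<noteq> 2" "e = (v, u)" by auto
    then show "e \<in> Sigma br (\<lambda>v. E `` {v})" using E_symD in_V by (auto simp: br_def)
  next
    fix e assume "e \<in> Sigma br (\<lambda>v. E `` {v})"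
    then obtain u v where "e = (v, u)" "(v, u) \<in> E" "deg v \<noteq> 2" by (auto simp: br_def)
    then show "e \<in> prod.swap ` {e \<in> E. deg (snd e) \<noteq> 2}"
      using E_symD by (intro image_eqI[of _ _ "(u, v)"]) auto
  qed
  moreover have "card (prod.swap ` {e \<in> E. deg (snd e) \<noteq> 2}) = card {e \<in> E. deg (snd e) \<noteq> 2}"
    by (intro card_image inj_onI) (auto simp: prod.swap_def)
  ultimately have "card {e \<in> E. deg (snd e) \<noteq> 2} = card (Sigma br (\<lambda>v. E `` {v}))" by simp
  also have "\<dots> = (\<Sum>v\<in>br. deg v)" using fin finite_nbhd by (simp add: card_SigmaI)
  also have "\<dots> \<le> (\<Sum>v\<in>br. 3 * (deg v - 2))"
  proof (rule sum_mono)
    fix v assume "v \<in> br"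
    then have "deg v \<ge> 2" "deg v \<noteq> 2" using deg_ge2 by (auto simp: br_def)
    then show "deg v \<le> 3 * (deg v - 2)" by linarith
  qed
  also have "\<dots> \<le> (\<Sum>v\<in>V. 3 * (deg v - 2))"
    using finite_V by (intro sum_mono2) (auto simp: br_def)
  also have "\<dots> = 3 * (\<Sum>v\<in>V. deg v - 2)" by (simp add: sum_distrib_left)
  also have "(\<Sum>v\<in>V. deg v - 2) + (\<Sum>v\<in>V. 2) = (\<Sum>v\<in>V. deg v)"
    unfolding sum.distrib[symmetric] using deg_ge2 le_add_diff_inverse2 by (intro sum.cong) blast+
  then have "(\<Sum>v\<in>V. deg v - 2) + 2 * card V = card E"
    using card_rel_eq_sum_degree[OF finite_V E_sub] by simp
  then have "(\<Sum>v\<in>V. deg v - 2) \<le> 2 * (t - 1)" using assms by linarith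
  finally show ?thesis by linarith
qed

end

text \<open>By \<open>card_arcs_le\<close> and \<open>card_branch_arcs_le\<close>, too many arcs
  force some walk to avoid branch vertices for \<open>Suc L\<close> steps. If it met itself, it
  would close up to a cycle that is the whole graph, which is impossible for
  \<open>2 <= t\<close>.\<close>

lemma (in min_deg2_graph) long_suspended_path:
  assumes "card E + 2 = 2 * card V + 2 * t" "2 \<le> t" "6 * (t - 1) * Suc L < card E"
  obtains q where "inj_on q {..Suc L}" "\<And>i. i \<le> L \<Longrightarrow> (q i, q (Suc i)) \<in> E"
    "\<And>i. 1 \<le> i \<Longrightarrow> i \<le> L \<Longrightarrow> deg (q i) = 2"
proof -
  have "\<exists>e\<in>E. \<forall>i. 1 \<le> i \<and> i \<le> Suc L \<longrightarrow> deg (walk e i) = 2"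
  proof (rule ccontr)
    assume "\<not> ?thesis"
    then have "card E \<le> card {e \<in> E. deg (snd e) \<noteq> 2} * Suc L"
      by (intro card_arcs_le) blast
    also have "\<dots> \<le> 6 * (t - 1) * Suc L"
      using card_branch_arcs_le[OF assms(1)] by (rule mult_le_mono1)
    finally show False using assms(3) by simp
  qed
  then obtain e where e: "e \<in> E" "\<And>i. 1 \<le> i \<Longrightarrow> i \<le> Suc L \<Longrightarrow> deg (walk e i) = 2" by blast
  \<comment> \<open>Dropping the starting vertex of the walk makes \<open>q 0\<close> have degree 2
    as well, as \<open>closed_walk_spans\<close> demands of every vertex on the cycle.\<close>
  define q where "q i = walk e (Suc i)" for i
  have q: "(q i, q (Suc i)) \<in> E" "q (Suc (Suc i)) \<noteq> q i" for i
    unfolding q_def using walk_arc[OF e(1)] walk_nonbacktracking[OF e(1)] by auto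
  have deg2: "deg (q i) = 2" if "i \<le> L" for i using e(2)[of "Suc i"] that by (simp add: q_def)
  have "inj_on q {..Suc L}"
  proof (rule ccontr)
    assume "\<not> inj_on q {..Suc L}"
    then obtain j where j: "3 \<le> j" "j \<le> Suc L" "inj_on q {..<j}" "q j = q 0"
      using walk_repeats_at_start[of q L] q deg2 by metis
    have "deg (q i) = 2" if "i < j" for i using deg2 that j(2) by simp
    then have "V = q ` {..<j}" using closed_walk_spans(1)[of q j] q j by blast
    then have "deg v = 2" if "v \<in> V" for v using that \<open>\<And>i. i < j \<Longrightarrow> deg (q i) = 2\<close> by auto
    then have "card E = (\<Sum>v\<in>V. 2)" using card_rel_eq_sum_degree[OF finite_V E_sub] by simp
    then show False using assms(1,2) by simp
  qed
  then show thesis using that q(1) deg2 by blast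
qed

section \<open>Embedding when all red degrees are bounded\<close>

context cycle_free_host
begin

text \<open>At most \<open>n - 1\<close> vertices are occupied and at most \<open>n + k - 2\<close>
  are red to \<open>f u\<close>; together they miss one of the \<open>2 * n + k - 2\<close> host
  vertices.\<close>

lemma embeds_add_leaf:
  assumes "conn_graph V E" "v \<in> V" "E `` {v} = {u}" "embeds (V - {v}) (E \<inter> (V - {v}) \<times> (V - {v})) R X"
    and "card V \<le> n" "2 * n + k - 2 \<le> card X" "\<And>x. x \<in> X \<Longrightarrow> card {y \<in> X. R x y} \<le> n + k - 2"
  shows "embeds V E R X"
proof -
  interpret conn_graph V E by fact
  obtain f where f: "inj_on f (V - {v})" "f ` (V - {v}) \<subseteq> X"
    "\<And>a b. (a, b) \<in> E \<inter> (V - {v}) \<times> (V - {v}) \<Longrightarrow> \<not> R (f a) (f b)"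
    using assms(4) by (rule embedsE) (rule that)
  have "(v, u) \<in> E" using assms(3) by auto
  then have uv: "u \<noteq> v" "u \<in> V" using E_irrefl in_V by blast+
  then have fu: "f u \<in> X" using f(2) by auto
  let ?U = "f ` (V - {v}) \<union> {y \<in> X. R (f u) y}"
  have "card ?U \<le> card (f ` (V - {v})) + card {y \<in> X. R (f u) y}" by (rule card_Un_le)
  also have "card (f ` (V - {v})) = card V - 1" using f(1) assms(2) by (simp add: card_image)
  also have "card V - 1 + card {y \<in> X. R (f u) y} < card X"
    using assms(5,6) assms(7)[OF fu] k_ge card_gt_0_iff[of V] finite_V assms(2) by auto
  finally have "\<not> X \<subseteq> ?U" using card_mono[of ?U X] finite_V finite_X by auto
  then obtain x where x: "x \<in> X" "x \<notin> f ` (V - {v})" "\<not> R (f u) x" by auto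
  define g where "g = f(v := x)"
  have gf: "g a = f a" if "a \<noteq> v" for a using that by (simp add: g_def)
  have gv: "g v = x" by (simp add: g_def)
  have "inj_on g (insert v (V - {v}))"
    using f(1) x(2) unfolding inj_on_insert by (auto simp: g_def inj_on_def)
  then have "inj_on g V" using assms(2) by (simp add: insert_absorb)
  moreover have "g ` V \<subseteq> X" using f(2) x(1) by (auto simp: g_def)
  moreover have "\<not> R (g a) (g b)" if ab: "(a, b) \<in> E" for a b
  proof -
    consider "a = v" | "b = v" | "a \<noteq> v" "b \<noteq> v" by auto
    then show ?thesis
    proof cases
      case 1
      then have "b = u" using ab assms(3) by auto
      then show ?thesis using 1 x(3) R_sym gf[OF uv(1)] gv by simp
    next
      case 2
      then have "a = u" using E_symD[OF ab] assms(3) by auto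
      then show ?thesis using 2 x(3) gf[OF uv(1)] gv by simp
    next
      case 3
      then show ?thesis using f(3)[of a b] ab in_V[OF ab] gf by auto
    qed
  qed
  ultimately show ?thesis by (rule embedsI)
qed

text \<open>Average degree 2 and minimum degree 2 force all degrees to be 2, so a non-backtracking
  walk closes up to a spanning cycle. Its vertices are matched with a blue cycle of the same
  length.\<close>

lemma embeds_cycle:
  assumes "min_deg2_graph V E" "card E = 2 * card V" "3 * k + 1 \<le> n" "card V \<le> n" "2 * n + k - 2 \<le> card X"
  shows "embeds V E R X"
proof -
  interpret min_deg2_graph V E by fact
  have deg2: "deg v = 2" if "v \<in> V" for v
  proof (rule ccontr)
    assume "deg v \<noteq> 2"
    then have "2 < deg v" using deg_ge2[OF that] by simp
    then have "(\<Sum>v\<in>V. 2) < (\<Sum>v\<in>V. deg v)"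
      using finite_V deg_ge2 that by (intro sum_strict_mono_ex1) auto
    then show False using card_rel_eq_sum_degree[OF finite_V E_sub] assms(2) by simp
  qed
  obtain v where "v \<in> V" using V_ne by auto
  then have "E `` {v} \<noteq> {}" using deg2 by fastforce
  then obtain e where e: "e \<in> E" by auto
  define q where "q = walk e"
  have q: "(q i, q (Suc i)) \<in> E" "q (Suc (Suc i)) \<noteq> q i" for i
    unfolding q_def using walk_arc[OF e] walk_nonbacktracking[OF e] by auto
  then have qV: "q i \<in> V" for i using in_V by blast
  have "\<not> inj_on q {..Suc (card V)}"
  proof
    assume "inj_on q {..Suc (card V)}"
    then have "card {..Suc (card V)} \<le> card V" using qV finite_V by (intro card_inj_on_le[of q]) auto
    then show False by simp
  qed
  then obtain j where j: "3 \<le> j" "inj_on q {..<j}" "q j = q 0"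
    using walk_repeats_at_start[of q "card V"] q deg2[OF qV] by metis
  have V: "V = q ` {..<j}" and arcs: "\<And>u v. (u, v) \<in> E \<Longrightarrow>
      \<exists>i<j. (u = q i \<and> v = q (Suc i)) \<or> (v = q i \<and> u = q (Suc i))"
    using closed_walk_spans[of q j] q j deg2[OF qV] by blast+
  have "card V = j" using V j(2) by (simp add: card_image)
  then obtain xs where xs: "distinct xs" "set xs \<subseteq> X" "successively B xs" "B (last xs) (hd xs)" "length xs = j"
    using has_blue_cycle_all_lengths[OF assms(3,5) j(1)] assms(4) unfolding has_blue_cycle_def by auto
  define f where "f v = xs ! (the_inv_into {..<j} q v)" for v
  have fq: "f (q i) = xs ! i" if "i < j" for i
    using the_inv_into_f_f[OF j(2), of i] that by (simp add: f_def)
  have "inj_on f V"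
  proof (rule inj_onI)
    fix a b assume "a \<in> V" "b \<in> V" "f a = f b"
    then show "a = b" using V fq xs(1,5) by (auto simp: nth_eq_iff_index_eq)
  qed
  moreover have "f ` V \<subseteq> X"
  proof
    fix y assume "y \<in> f ` V"
    then obtain i where "i < j" "y = xs ! i" using V fq by auto
    then show "y \<in> X" using xs(2,5) nth_mem by blast
  qed
  moreover have blue: "\<not> R (f (q i)) (f (q (Suc i)))" if "i < j" for i
  proof (cases "Suc i = j")
    case True
    have "xs \<noteq> []" using xs(5) j(1) by auto
    then have "f (q (Suc i)) = hd xs" "f (q i) = last xs"
      using True fq[of 0] fq[of i] j xs(5) by (auto simp: hd_conv_nth last_conv_nth)
    then show ?thesis using xs(4) by simp
  next
    case False
    then show ?thesis using fq[of i] fq[of "Suc i"] that xs(3,5) successively_nth[of B xs i] by simp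
  qed
  moreover have "\<not> R (f a) (f b)" if "(a, b) \<in> E" for a b
    using arcs[OF that] blue R_sym by blast
  ultimately show ?thesis by (intro embedsI)
qed

text \<open>\<open>path_insertion\<close> may change the order of the old path vertices. This is
  harmless: inner vertices of a suspended path have no further neighbours, so they are reassigned
  along the new path and only its ends keep their images. If the vertices outside are pairwise blue
  they host the whole graph; otherwise a red edge among them and
  \<open>dense_red_bipartite_no_edge\<close> yield a vertex that can be inserted.\<close>

lemma embeds_lengthen_path:
  assumes "conn_graph V E" and q: "inj_on q {..Suc L}" "\<And>i. i \<le> L \<Longrightarrow> (q i, q (Suc i)) \<in> E"
    "\<And>i. 1 \<le> i \<Longrightarrow> i \<le> L \<Longrightarrow> card (E `` {q i}) = 2" and L: "3 * k \<le> L"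
    and IH: "embeds (V - {q 1}) (E \<inter> (V - {q 1}) \<times> (V - {q 1}) \<union> {(q 0, q 2), (q 2, q 0)}) R X"
    and "card V \<le> n" "k \<le> n" "2 * n + k - 2 \<le> card X"
  shows "embeds V E R X"
proof -
  interpret conn_graph V E by fact
  let ?V = "V - {q 1}" and ?E = "E \<inter> (V - {q 1}) \<times> (V - {q 1}) \<union> {(q 0, q 2), (q 2, q 0)}"
  obtain f where f: "inj_on f ?V" "f ` ?V \<subseteq> X" "\<And>a b. (a, b) \<in> ?E \<Longrightarrow> \<not> R (f a) (f b)"
    using IH by (rule embedsE) (rule that)
  have qV: "q i \<in> V" if "i \<le> Suc L" for i
    using in_V(1)[OF q(2)[of i]] in_V(2)[OF q(2)[of L]] that by (cases "i \<le> L") (auto simp: le_Suc_eq)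
  have qinj: "q i = q i' \<longleftrightarrow> i = i'" if "i \<le> Suc L" "i' \<le> Suc L" for i i'
    using inj_on_eq_iff[OF q(1)] that by auto
  \<comment> \<open>Indices along the shortened path, in which \<open>q 0\<close> is followed
    directly by \<open>q 2\<close>.\<close>
  define js where "js = 0 # [2..<Suc (Suc L)]"
  define qs where "qs = map q js"
  define ps where "ps = map f qs"
  have js: "distinct js" "set js = {..Suc L} - {1}" "js \<noteq> []" "hd js = 0" "last js = Suc L"
    using L k_ge by (auto simp: js_def)
  have qs: "distinct qs" "set qs \<subseteq> ?V" "qs \<noteq> []"
    using js qV qinj L k_ge by (auto simp: qs_def distinct_map inj_on_def)
  have sq: "set qs = q ` ({..Suc L} - {1})" using js(2) by (simp add: qs_def)
  have "distinct ps" using qs(1) inj_on_subset[OF f(1) qs(2)] by (simp add: ps_def distinct_map)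
  moreover have "set ps \<subseteq> X" using qs(2) f(2) by (auto simp: ps_def)
  moreover have "ps \<noteq> []" "hd ps = f (q 0)" "last ps = f (q (Suc L))"
    using js(3-5) by (simp_all add: ps_def qs_def hd_map last_map)
  ultimately have ps: "distinct ps" "set ps \<subseteq> X" "ps \<noteq> []" "hd ps = f (q 0)" "last ps = f (q (Suc L))"
    by simp_all
  have len: "length ps = Suc L" using L k_ge by (simp add: ps_def qs_def js_def)
  have sps: "set ps = f ` set qs" by (simp add: ps_def)
  have blue_step: "\<not> R (f (q i)) (f (q (Suc i)))" if "2 \<le> i" "i \<le> L" for i
  proof (rule f(3))
    show "(q i, q (Suc i)) \<in> ?E" using q(2)[OF that(2)] qV qinj that by auto
  qed
  have blue02: "\<not> R (f (q 0)) (f (q 2))" by (rule f(3)) simp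
  have "successively (\<lambda>i i'. \<not> R (f (q i)) (f (q i'))) [2..<m]" if "m \<le> Suc (Suc L)" for m
    using that
  proof (induction m)
    case (Suc m)
    show ?case
    proof (cases "m \<le> 2")
      case False
      then obtain m' where m': "m = Suc m'" by (cases m) auto
      then show ?thesis
        using Suc False blue_step[of m'] by (auto simp: successively_append_iff)
    qed (auto simp: le_Suc_eq numeral_2_eq_2)
  qed simp
  from this[OF order_refl] have "successively (\<lambda>i i'. \<not> R (f (q i)) (f (q i'))) js"
    using blue02 hd_upt[of 2 "Suc (Suc L)"] L k_ge unfolding js_def successively_Cons by (simp del: upt_Suc)
  then have psB: "successively B ps" by (simp add: ps_def qs_def successively_map)
  define W where "W = X - f ` ?V"
  have WX: "W \<subseteq> X" by (auto simp: W_def)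
  have finW: "finite W" using finite_X by (simp add: W_def)
  have "card (f ` ?V) = card V - 1" using f(1) qV[of 1] by (simp add: card_image)
  then have "card W = card X - (card V - 1)"
    using f(2) finite_X finite_V by (simp add: W_def card_Diff_subset)
  moreover have "card V \<ge> 1" using finite_V V_ne by (simp add: Suc_le_eq card_gt_0_iff)
  ultimately have cW: "card V \<le> card W" "k \<le> card W" using assms(7-9) k_ge by linarith+
  define Q where "Q = set (butlast ps)"
  have "Q \<subseteq> set ps" by (auto simp: Q_def dest: in_set_butlastD)
  moreover have "set ps \<subseteq> f ` ?V" using sps qs(2) by auto
  ultimately have Q: "Q \<subseteq> X" "W \<inter> Q = {}" using f(2) unfolding W_def by blast+
  have cQ: "card Q = L" using ps(1) len by (simp add: Q_def distinct_butlast distinct_card)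
  show ?thesis
  proof (cases "\<forall>x\<in>W. \<forall>y\<in>W. \<not> R x y")
    case True
    then show ?thesis
      using embeds_independent[OF finite_V finW E_sub cW(1) order_refl, of R] embeds_mono WX by blast
  next
    case False
    then obtain x y where xy: "x \<in> W" "y \<in> W" "R x y" by auto
    \<comment> \<open>This is where \<open>3 * k <= L\<close> enters: a vertex that cannot be
      inserted has at most \<open>k - 2\<close> blue neighbours in \<open>Q\<close>, so
      \<open>b = k - 2\<close> and \<open>Q\<close> is large enough for the red cycle.\<close>
    have "2 * (k - 2) + k \<le> card Q" using L cQ by simp
    then have "\<not> (\<forall>w\<in>W. card {p \<in> Q. B w p} \<le> k - 2)"
      using dense_red_bipartite_no_edge[OF Q(1) WX Q(2) _ _ cW(2) xy(1,2), of "k - 2"] xy(3) by blast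
    then obtain w where w: "w \<in> W" "k - 1 \<le> card {p \<in> set (butlast ps). B w p}"
      by (auto simp: Q_def not_le)
    have wX: "w \<in> X" "w \<notin> f ` ?V" using w(1) by (auto simp: W_def)
    then have "w \<notin> set ps" using sps qs(2) by auto
    then obtain rs where rs: "distinct rs" "set rs = insert w (set ps)" "successively B rs"
      "hd rs = hd ps" "last rs = last ps"
      using path_insertion[OF ps(1,2) psB wX(1) _ ps(3) w(2)] by metis
    have lrs: "length rs = Suc (Suc L)"
      using rs(1,2) ps(1) len \<open>w \<notin> set ps\<close> distinct_card[of rs] distinct_card[of ps] by simp
    define g where "g v = (if v \<in> q ` {..Suc L} then rs ! the_inv_into {..Suc L} q v else f v)" for v
    have gq: "g (q i) = rs ! i" if "i \<le> Suc L" for i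
      using the_inv_into_f_f[OF q(1), of i] that by (simp add: g_def)
    have gf: "g v = f v" if "v \<notin> q ` {1..L}" for v
    proof (cases "v \<in> q ` {..Suc L}")
      case True
      then obtain i where i: "i \<le> Suc L" "v = q i" by auto
      then have "i \<notin> {1..L}" using that by blast
      then have "i = 0 \<or> i = Suc L" using i(1) by auto
      moreover have "rs \<noteq> []" using lrs by auto
      then have "rs ! 0 = f (q 0)" "rs ! Suc L = f (q (Suc L))"
        using rs(4,5) ps(4,5) lrs by (auto simp: hd_conv_nth last_conv_nth)
      ultimately show ?thesis using gq i by auto
    qed (simp add: g_def)
    have grs: "g (q i) \<in> insert w (set ps)" if "i \<le> Suc L" for i
      using gq[OF that] rs(2) lrs nth_mem[of i rs] that by auto
    have off: "f v \<notin> insert w (set ps)" if "v \<in> V" "v \<notin> q ` {..Suc L}" for v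
    proof -
      have vV: "v \<in> ?V" using that L k_ge by auto
      have "f v \<noteq> w" using vV wX(2) by auto
      moreover have "v \<notin> set qs" using that(2) sq by auto
      then have "f v \<notin> f ` set qs" using inj_on_image_mem_iff[OF f(1) vV qs(2)] by simp
      ultimately show ?thesis using sps by simp
    qed
    have "inj_on g V"
    proof (rule inj_onI)
      fix a b assume ab: "a \<in> V" "b \<in> V" "g a = g b"
      consider "a \<in> q ` {..Suc L}" "b \<in> q ` {..Suc L}" | "a \<in> q ` {..Suc L}" "b \<notin> q ` {..Suc L}"
        | "a \<notin> q ` {..Suc L}" "b \<in> q ` {..Suc L}" | "a \<notin> q ` {..Suc L}" "b \<notin> q ` {..Suc L}" by blast
      then show "a = b"
      proof cases
        case 1
        then obtain i i' where "a = q i" "b = q i'" "i \<le> Suc L" "i' \<le> Suc L" by auto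
        then show ?thesis using ab(3) gq rs(1) lrs by (auto simp: nth_eq_iff_index_eq)
      next
        case 2
        then obtain i where "a = q i" "i \<le> Suc L" by auto
        then have "g a \<in> insert w (set ps)" using grs by simp
        moreover have "g b = f b" using 2 by (simp add: g_def)
        ultimately show ?thesis using off[OF ab(2)] 2 ab(3) by simp
      next
        case 3
        then obtain i where "b = q i" "i \<le> Suc L" by auto
        then have "g b \<in> insert w (set ps)" using grs by simp
        moreover have "g a = f a" using 3 by (simp add: g_def)
        ultimately show ?thesis using off[OF ab(1)] 3 ab(3) by simp
      next
        case 4
        then have "f a = f b" "a \<in> ?V" "b \<in> ?V" using ab L k_ge by (auto simp: g_def)
        then show ?thesis using inj_onD[OF f(1)] by blast
      qed
    qed
    moreover have "g ` V \<subseteq> X"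
    proof
      fix y assume "y \<in> g ` V"
      then obtain v where v: "v \<in> V" "y = g v" by auto
      show "y \<in> X"
      proof (cases "v \<in> q ` {..Suc L}")
        case True
        then show ?thesis using grs v(2) ps(2) wX(1) by auto
      next
        case False
        then have "v \<in> ?V" "g v = f v" using v(1) L k_ge by (auto simp: g_def)
        then show ?thesis using f(2) v(2) by auto
      qed
    qed
    moreover have step: "\<not> R (g (q i)) (g (q (Suc i)))" if "i \<le> L" for i
      using successively_nth[OF rs(3), of i] gq[of i] gq[of "Suc i"] lrs that by simp
    have inner: "\<not> R (g a) (g b)" if ab: "(a, b) \<in> E" "a \<in> q ` {1..L}" for a b
    proof -
      obtain i where i: "a = q i" "1 \<le> i" "i \<le> L" using ab(2) by auto
      obtain i' where i': "i = Suc i'" using i(2) by (cases i) auto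
      have "(q i, q i') \<in> E" "(q i, q (Suc i)) \<in> E" using q(2)[of i'] q(2)[of i] E_symD i i' by auto
      moreover have "q i' \<noteq> q (Suc i)" using qinj[of i' "Suc i"] i i' by simp
      ultimately have "E `` {q i} = {q i', q (Suc i)}" using nbhd_eq q(3)[OF i(2,3)] by blast
      then have "b = q i' \<or> b = q (Suc i)" using ab(1) i(1) by auto
      then show ?thesis using step[of i'] step[of i] i i' R_sym by auto
    qed
    have "\<not> R (g a) (g b)" if ab: "(a, b) \<in> E" for a b
    proof -
      consider "a \<in> q ` {1..L}" | "b \<in> q ` {1..L}" | "a \<notin> q ` {1..L}" "b \<notin> q ` {1..L}" by blast
      then show ?thesis
      proof cases
        case 1
        then show ?thesis by (rule inner[OF ab])
      next
        case 2
        then show ?thesis using inner[OF E_symD[OF ab]] R_sym by blast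
      next
        case 3
        have "q 1 \<in> q ` {1..L}" using L k_ge by auto
        then have "a \<noteq> q 1" "b \<noteq> q 1" using 3 by auto
        then have "(a, b) \<in> ?E" using ab in_V[OF ab] by auto
        then show ?thesis using f(3) gf[OF 3(1)] gf[OF 3(2)] by simp
      qed
    qed
    ultimately show ?thesis by (intro embedsI)
  qed
qed

text \<open>Without leaves there are at least as many edges as vertices, so \<open>t >= 1\<close>,
  and \<open>t = 1\<close> means a cycle. For \<open>t >= 2\<close> the number of arcs decides: many
  arcs force a suspended path, few allow the greedy embedding. The bound on \<open>t\<close> refers
  to \<open>n\<close>, not to \<open>card V\<close>, and so survives the induction.\<close>

lemma embeds_sparse_connected:
  assumes "3 * k + 1 \<le> n" "2 * n + k - 2 \<le> card X" "\<And>x. x \<in> X \<Longrightarrow> card {y \<in> X. R x y} \<le> n + k - 2"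
    and "2 \<le> t \<Longrightarrow> 27 * k\<^sup>2 * (t - 1) \<le> n"
    and "conn_graph V E" "card V \<le> n" "card E + 2 = 2 * card V + 2 * t"
  shows "embeds V E R X"
  using assms(5-7)
proof (induction "card V" arbitrary: V E rule: less_induct)
  case less
  interpret conn_graph V E by fact
  have cV: "card V \<ge> 1" using finite_V V_ne by (simp add: Suc_le_eq card_gt_0_iff)
  have "card V = 1 \<or> card V \<ge> 2" using cV by linarith
  then consider "card V = 1" | v where "v \<in> V" "deg v = 1" | "card V \<ge> 2" "\<forall>v\<in>V. deg v \<noteq> 1"
    by blast
  then show ?case
  proof cases
    case 1
    then obtain v where v: "V = {v}" by (auto simp: card_1_singleton_iff)
    have "X \<noteq> {}" using assms(1,2) k_ge by auto
    then obtain x where "x \<in> X" by auto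
    then show ?thesis using v E_sub E_irrefl by (intro embedsI[of "\<lambda>_. x"]) auto
  next
    case (2 v)
    then obtain u where u: "E `` {v} = {u}" by (auto simp: card_1_singleton_iff)
    have "(v, u) \<in> E" using u by auto
    then have "{(v, u), (u, v)} \<subseteq> E" "u \<noteq> v" using E_symD E_irrefl by auto
    then have "2 \<le> card E" using card_mono[OF finite_E, of "{(v, u), (u, v)}"] by simp
    moreover have "card (V - {v}) = card V - 1" using 2(1) by simp
    ultimately have "embeds (V - {v}) (E \<inter> (V - {v}) \<times> (V - {v})) R X"
      using remove_leaf[OF 2(1) u] less.prems(2,3) cV by (intro less.hyps) auto
    then show ?thesis
      using embeds_add_leaf[OF less.prems(1) 2(1) u _ less.prems(2) assms(2,3)] by blast
  next
    case 3
    have "2 \<le> deg v" if "v \<in> V" for v using deg_pos[OF that 3(1)] 3(2) that by fastforce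
    then interpret min_deg2_graph V E by unfold_locales
    have "(\<Sum>v\<in>V. 2) \<le> (\<Sum>v\<in>V. deg v)" using deg_ge2 by (intro sum_mono)
    then have "2 * card V \<le> card E" using card_rel_eq_sum_degree[OF finite_V E_sub] by simp
    then consider "t = 1" | "2 \<le> t" using less.prems(3) by linarith
    then show ?thesis
    proof cases
      case 1
      then show ?thesis
        using embeds_cycle[OF min_deg2_graph_axioms _ assms(1) less.prems(2) assms(2)] less.prems(3) by simp
    next
      case t: 2
      show ?thesis
      proof (cases "6 * (t - 1) * Suc (3 * k) < card E")
        case True
        obtain q where q: "inj_on q {..Suc (3 * k)}" "\<And>i. i \<le> 3 * k \<Longrightarrow> (q i, q (Suc i)) \<in> E"
            "\<And>i. 1 \<le> i \<Longrightarrow> i \<le> 3 * k \<Longrightarrow> deg (q i) = 2"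
          using long_suspended_path[OF less.prems(3) t True] by metis
        have qinj: "q i = q i' \<longleftrightarrow> i = i'" if "i \<le> 3 * k" "i' \<le> 3 * k" for i i'
          using inj_on_eq_iff[OF q(1)] that by auto
        have a: "(q 1, q 0) \<in> E" "(q 1, q 2) \<in> E" "(q 2, q 1) \<in> E" "(q 2, q 3) \<in> E"
          using q(2)[of 0] q(2)[of 1] q(2)[of 2] E_symD k_ge by (auto simp: numeral_2_eq_2 numeral_3_eq_3)
        have nb1: "E `` {q 1} = {q 0, q 2}"
          using nbhd_eq[OF a(1,2)] q(3)[of 1] qinj[of 0 2] k_ge by simp
        have nb2: "E `` {q 2} = {q 1, q 3}"
          using nbhd_eq[OF a(3,4)] q(3)[of 2] qinj[of 1 3] k_ge by simp
        have "q 0 \<noteq> q 1" "q 0 \<noteq> q 3" "q 0 \<noteq> q 2" using qinj[of 0] k_ge by auto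
        \<comment> \<open>The neighbours of \<open>q 2\<close> are \<open>q 1\<close> and
          \<open>q 3\<close>, so the shortcut is a new edge and the arc count of the contraction is
          exact.\<close>
        then have no: "(q 0, q 2) \<notin> E" using nb2 E_symD by blast
        have q1: "q 1 \<in> V" using in_V a by blast
        note con = contract[OF nb1 \<open>q 0 \<noteq> q 2\<close> no q1]
        have "embeds (V - {q 1}) (E \<inter> (V - {q 1}) \<times> (V - {q 1}) \<union> {(q 0, q 2), (q 2, q 0)}) R X"
        proof (rule less.hyps)
          show "card (V - {q 1}) < card V" using q1 finite_V by (meson card_Diff1_less)
          show "card (V - {q 1}) \<le> n" using less.prems(2) q1 by simp
          have "card (V - {q 1}) = card V - 1" using q1 by simp
          then show "card (E \<inter> (V - {q 1}) \<times> (V - {q 1}) \<union> {(q 0, q 2), (q 2, q 0)}) + 2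
            = 2 * card (V - {q 1}) + 2 * t"
            using con(2,3) less.prems(3) cV by linarith
        qed (rule con(1))
        then show ?thesis
          using embeds_lengthen_path[OF less.prems(1) q order_refl _ less.prems(2) _ assms(2)] assms(1)
          by simp
      next
        case False
        \<comment> \<open>The greedy embedding needs \<open>card E * (k - 2) + card V\<close> host
          vertices; the first summand is at most \<open>n\<close> by the bound on the
          excess.\<close>
        have "card E * (k - 2) \<le> 6 * (t - 1) * Suc (3 * k) * (k - 2)"
          using False by (intro mult_le_mono1) simp
        also have "\<dots> = (t - 1) * (6 * (Suc (3 * k) * (k - 2)))" by (simp only: ac_simps)
        also have "\<dots> \<le> (t - 1) * (27 * k\<^sup>2)"
        proof (rule mult_le_mono2)
          obtain j where "k = j + 3" using k_ge by (metis le_add_diff_inverse2)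
          then show "6 * (Suc (3 * k) * (k - 2)) \<le> 27 * k\<^sup>2" by (simp add: power2_eq_square algebra_simps)
        qed
        also have "\<dots> \<le> n" using assms(4)[OF t] by (simp add: mult.commute)
        finally have "card E * (k - 2) + card V \<le> card X" using less.prems(2) assms(2) k_ge by linarith
        then show ?thesis by (intro embeds_if_few_arcs[OF finite_V E_sub E_sym])
      qed
    qed
  qed
qed

end

section \<open>Ramsey numbers\<close>

text \<open>If no arc left \<open>S\<close>, induction along a walk that starts in \<open>S\<close>
  would keep it in \<open>S\<close>.\<close>

lemma conn_graph_if_connected:
  assumes "pair_graph G" "Digraph_Component.connected (with_proj G)"
  shows "conn_graph (pverts G) (parcs G)"
proof -
  interpret pair_graph G by fact
  have sc: "strongly_connected (with_proj (mk_symmetric (with_proj G)))"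
    using assms(2) by (simp add: Digraph_Component.connected_def)
  have arcs: "parcs (mk_symmetric (with_proj G)) = parcs G"
    by (auto simp: parcs_mk_symmetric dest: arcs_symmetric)
  show ?thesis
  proof
    show "finite (pverts G)" by simp
    show "pverts G \<noteq> {}" using sc by (auto simp: strongly_connected_def)
    show "parcs G \<subseteq> pverts G \<times> pverts G" using in_arcsD1 in_arcsD2 by auto
    show "sym (parcs G)" by (auto simp: sym_def dest: arcs_symmetric)
    show "(v, v) \<notin> parcs G" for v
    proof
      assume "(v, v) \<in> parcs G"
      from no_loops[OF this] show False by simp
    qed
    fix S assume S: "S \<subseteq> pverts G" "S \<noteq> {}" "S \<noteq> pverts G"
    then obtain u v where uv: "u \<in> S" "v \<in> pverts G - S" by blast
    have "reachable (with_proj (mk_symmetric (with_proj G))) u v"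
      using sc uv S(1) by (auto simp: strongly_connected_def)
    then have "(u, v) \<in> rtrancl_on (pverts G) (parcs G)"
      by (simp add: reachable_def arcs)
    then have "v \<in> S" if "\<not> (\<exists>a\<in>S. \<exists>b\<in>pverts G - S. (a, b) \<in> parcs G)"
      using uv(1)
    proof (induction rule: rtrancl_on_induct)
      case (step y z)
      then show ?case using that by blast
    qed
    then show "\<exists>a\<in>S. \<exists>b\<in>pverts G - S. (a, b) \<in> parcs G" using uv(2) by blast
  qed
qed

lemma card_parcs:
  assumes "pair_graph G"
  shows "card (parcs G) = 2 * card (uedges G)"
proof -
  interpret pair_graph G by fact
  have fin: "finite (parcs G)" by simp
  have fib: "{a \<in> parcs G. (\<lambda>(u, v). {u, v}) a = e} = {(u, v), (v, u)}" "u \<noteq> v"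
    if "e = {u, v}" "(u, v) \<in> parcs G" for e u v
  proof -
    show "u \<noteq> v" using no_loops[OF that(2)] by simp
    show "{a \<in> parcs G. (\<lambda>(u, v). {u, v}) a = e} = {(u, v), (v, u)}"
    proof (intro set_eqI iffI)
      fix a assume "a \<in> {a \<in> parcs G. (\<lambda>(u, v). {u, v}) a = e}"
      then have "{fst a, snd a} = {u, v}" using that(1) by (simp add: case_prod_beta)
      then show "a \<in> {(u, v), (v, u)}" by (cases a) (simp add: doubleton_eq_iff)
    next
      fix a assume "a \<in> {(u, v), (v, u)}"
      then have "a \<in> parcs G" "{fst a, snd a} = {u, v}"
        using that(2) arcs_symmetric[OF that(2)] by (elim insertE, simp_all add: insert_commute)+
      then show "a \<in> {a \<in> parcs G. (\<lambda>(u, v). {u, v}) a = e}"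
        using that(1) by (simp add: case_prod_beta)
    qed
  qed
  have "uedges G = (\<lambda>(u, v). {u, v}) ` parcs G" by (auto simp: uedges_def image_def)
  then have "card (parcs G) = (\<Sum>e\<in>uedges G. card {a \<in> parcs G. (\<lambda>(u, v). {u, v}) a = e})"
    using sum.image_gen[OF fin, of "\<lambda>_. 1::nat" "\<lambda>(u, v). {u, v}"] by simp
  also have "\<dots> = (\<Sum>e\<in>uedges G. 2)"
  proof (rule sum.cong)
    fix e assume "e \<in> uedges G"
    then obtain u v where "e = {u, v}" "(u, v) \<in> parcs G" by (auto simp: uedges_def)
    then show "card {a \<in> parcs G. (\<lambda>(u, v). {u, v}) a = e} = 2" using fib[of e u v] by simp
  qed simp
  finally show ?thesis by simp
qed

lemma contains_copy_if_embeds: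
  assumes "pair_graph \<Gamma>" "pair_graph G"
    and "embeds (pverts G) (parcs G) (\<lambda>x y. (x, y) \<in> parcs (complement \<Gamma>)) (pverts \<Gamma>)"
  shows "contains_copy \<Gamma> G"
proof -
  interpret G: pair_graph G by fact
  obtain f where f: "inj_on f (pverts G)" "f ` pverts G \<subseteq> pverts \<Gamma>"
    "\<And>u v. (u, v) \<in> parcs G \<Longrightarrow> (f u, f v) \<notin> parcs (complement \<Gamma>)"
    using assms(3) by (rule embedsE) (rule that)
  have "(f u, f v) \<in> parcs \<Gamma>" if uv: "(u, v) \<in> parcs G" for u v
  proof -
    have "u \<in> pverts G" "v \<in> pverts G" "u \<noteq> v"
      using G.in_arcsD1[OF uv] G.in_arcsD2[OF uv] G.no_loops[OF uv] by auto
    then show ?thesis using f(3)[OF uv] f(1,2) by (auto simp: complement_def inj_on_eq_iff)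
  qed
  then show ?thesis using contains_copyI[OF assms(1,2) f(1,2)] by blast
qed

lemma cycle_free_if_not_contains_copy:
  assumes "pair_graph \<Gamma>" "k \<ge> 3" "\<not> contains_copy \<Gamma> (cycle_graph k)"
  shows "cycle_free (\<lambda>x y. (x, y) \<in> parcs \<Gamma>) (pverts \<Gamma>) k"
  unfolding cycle_free_def
proof (intro allI impI notI)
  interpret pair_graph \<Gamma> by fact
  fix xs assume xs: "distinct xs \<and> set xs \<subseteq> pverts \<Gamma> \<and> successively (\<lambda>x y. (x, y) \<in> parcs \<Gamma>) xs \<and> length xs = k"
    and closing: "(last xs, hd xs) \<in> parcs \<Gamma>"
  have ne: "xs \<noteq> []" using xs assms(2) by auto
  have step: "(xs ! i, xs ! (Suc i mod k)) \<in> parcs \<Gamma>" if "i < k" for i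
  proof (cases "Suc i = k")
    case True
    then show ?thesis using closing xs ne by (auto simp: last_conv_nth hd_conv_nth)
  next
    case False
    then show ?thesis using xs that successively_nth[of "\<lambda>x y. (x, y) \<in> parcs \<Gamma>" xs i] by simp
  qed
  have "contains_copy \<Gamma> (cycle_graph k)"
  proof (rule contains_copyI[OF assms(1) pair_graph_cycle_graph[OF assms(2)], of "\<lambda>i. xs ! i"])
    show "inj_on ((!) xs) (pverts (cycle_graph k))"
      using xs by (auto simp: cycle_graph_def inj_on_def nth_eq_iff_index_eq)
    show "(!) xs ` pverts (cycle_graph k) \<subseteq> pverts \<Gamma>"
      using xs by (auto simp: cycle_graph_def)
    show "(xs ! u, xs ! v) \<in> parcs \<Gamma>" if "(u, v) \<in> parcs (cycle_graph k)" for u v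
    proof -
      have "u < k" "v < k" "v = Suc u mod k \<or> u = Suc v mod k"
        using that by (auto simp: cycle_graph_def)
      then show ?thesis using step[of u] step[of v] arcs_symmetric by metis
    qed
  qed
  then show False using assms(3) by simp
qed

theorem lemma5p3:
  fixes k n :: nat and G :: "'a pair_pre_digraph"
  assumes "k \<ge> 3" and "n \<ge> 3 * k + 1"
    and "pair_graph G" and "Digraph_Component.connected (with_proj G)"
    and "card (pverts G) = n"
    and "real (card (uedges G)) \<le> (1 + 1 / (27 * (real k)\<^sup>2)) * real n"
  shows "ramsey_number G (cycle_graph k) \<le> 2 * n + k - 2"
proof -
  define m where "m = card (uedges G)"
  interpret C: conn_graph "pverts G" "parcs G" by (rule conn_graph_if_connected[OF assms(3,4)])
  obtain r d par where "bfs_graph (pverts G) (parcs G) r d par" using C.bfs_graph_exists by blast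
  then interpret bfs_graph "pverts G" "parcs G" r d par .
  have cE: "card (parcs G) = 2 * m" using card_parcs[OF assms(3)] by (simp add: m_def)
  have "n \<ge> 1" using assms(2) by simp
  have "n - 1 \<le> m" using card_nontree cE assms(5) by linarith
  \<comment> \<open>\<open>t\<close> is the cyclomatic number, the number of edges beyond a spanning
    tree.\<close>
  then obtain t where t: "m = n - 1 + t" by (metis le_add_diff_inverse)
  have arcs: "card (parcs G) + 2 = 2 * card (pverts G) + 2 * t"
    using cE t assms(5) \<open>n \<ge> 1\<close> by simp
  have excess: "27 * k\<^sup>2 * (t - 1) \<le> n" if "2 \<le> t"
  proof -
    have "real m = real n + real (t - 1)" using t that \<open>n \<ge> 1\<close> by simp
    then have "real (t - 1) \<le> real n / (27 * (real k)\<^sup>2)"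
      using assms(6) by (simp add: m_def[symmetric] algebra_simps)
    moreover have "27 * (real k)\<^sup>2 > 0" using assms(1) by simp
    ultimately have "real (t - 1) * (27 * (real k)\<^sup>2) \<le> real n" by (simp add: pos_le_divide_eq)
    then have "real (27 * k\<^sup>2 * (t - 1)) \<le> real n" by (simp add: mult.commute)
    then show ?thesis by linarith
  qed
  have "ramsey_property G (cycle_graph k) (2 * n + k - 2)"
    unfolding ramsey_property_def
  proof (intro allI impI)
    fix \<Gamma> :: "nat pair_pre_digraph"
    assume \<Gamma>: "pair_graph \<Gamma> \<and> card (pverts \<Gamma>) = 2 * n + k - 2"
    show "contains_copy \<Gamma> G \<or> contains_copy (complement \<Gamma>) (cycle_graph k)"
    proof (rule disjCI)
      assume no: "\<not> contains_copy (complement \<Gamma>) (cycle_graph k)"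
      let ?R = "\<lambda>x y. (x, y) \<in> parcs (complement \<Gamma>)"
      interpret H: pair_graph "complement \<Gamma>" using \<Gamma> by (simp add: pair_graph_complement)
      have X: "pverts (complement \<Gamma>) = pverts \<Gamma>" by (simp add: complement_def)
      interpret cycle_free_host "pverts \<Gamma>" ?R k
      proof
        show "finite (pverts \<Gamma>)" using H.finite_verts by (simp add: X)
        show "symp ?R" using H.arcs_symmetric by (intro sympI)
        show "irreflp ?R" by (auto simp: complement_def irreflp_def)
        show "cycle_free ?R (pverts \<Gamma>) k"
          using cycle_free_if_not_contains_copy[OF pair_graph_complement assms(1) no] \<Gamma> X by simp
      qed (rule assms(1))
      have "embeds (pverts G) (parcs G) ?R (pverts \<Gamma>)"
      \<comment> \<open>A red degree above \<open>n + k - 2\<close> leaves \<open>n + k - 1\<close>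
        vertices, enough for the split with its loss of \<open>k - 3\<close>. Otherwise every vertex
        keeps at least \<open>n - 1\<close> blue neighbours, just enough to attach leaves.\<close>
      proof (cases "\<exists>x\<in>pverts \<Gamma>. n + k - 2 < card {y \<in> pverts \<Gamma>. ?R x y}")
        case True
        then obtain x where x: "x \<in> pverts \<Gamma>" "n + k - 2 < card {y \<in> pverts \<Gamma>. ?R x y}" by auto
        have pf: "path_free ?R {y \<in> pverts \<Gamma>. ?R x y} (k - 1)"
          by (rule path_free_red_nbhd[OF x(1) order_refl])
        have "embeds (pverts G) (parcs G) ?R {y \<in> pverts \<Gamma>. ?R x y}"
        proof (rule C.embeds_if_path_free[OF _ pf assms(1) symp_R irreflp_R])
          show "finite {y \<in> pverts \<Gamma>. ?R x y}" using finite_X by simp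
          show "card (pverts G) + (k - 3) \<le> card {y \<in> pverts \<Gamma>. ?R x y}"
            using x(2) assms(1,5) by linarith
          show "card (parcs G) = 2 * (card (pverts G) - 1) + 2 * t" using arcs assms(5) \<open>n \<ge> 1\<close> by simp
        qed (use assms(2,5) excess in auto)
        then show ?thesis by (rule embeds_mono) auto
      next
        case False
        then have "card {y \<in> pverts \<Gamma>. ?R x y} \<le> n + k - 2" if "x \<in> pverts \<Gamma>" for x
          using that by (meson not_le)
        then show ?thesis
          using embeds_sparse_connected[OF assms(2) _ _ excess C.conn_graph_axioms _ arcs] \<Gamma> assms(5)
          by simp
      qed
      then show "contains_copy \<Gamma> G"
        using contains_copy_if_embeds[OF _ assms(3)] \<Gamma> by blast
    qed
  qed
  moreover have "2 * n + k - 2 \<ge> 1" using assms(1,2) by simp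
  ultimately show ?thesis
    unfolding ramsey_number_def by (intro Least_le conjI)
qed

end
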